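(* Consider the finite-state team model in the context with $n$ agents and discount factor $\beta\in(0,1)$, and run the following Q-learning procedure. Set $Q_1(d,\gamma)=0$ and $\eta_1(d,\gamma)=1$ for all $(d,\gamma)\in\mathcal{E}_n(\mathcal{X})\times\mathcal{G}$. At iteration $k$, for the current pair $(d,\gamma)$ (deep state and applied local law), the system is run one step from deep state $d$ with every agent applying $u^i=\gamma(x^i)$, producing the immediate cost $\bar c'=\frac1n\sum_i c(x^i,u^i,\mathfrak{D})$ and next deep state $d'$, and one sets $Q_{k+1}(d,\gamma)=(1-\eta_k(d,\gamma))Q_k(d,\gamma)+\eta_k(d,\gamma)(\bar c'+\beta\min_{\gamma'\in\mathcal{G}}Q_k(d',\gamma'))$, with learning rates $\eta_k(d,\gamma)\in[0,1]$ satisfying $\sum_k\eta_k(d,\gamma)=\infty$ and $\sum_k\eta_k(d,\gamma)^2<\infty$. Suppose every pair $(d,\gamma)\in\mathcal{E}_n(\mathcal{X})\times\mathcal{G}$ is visited infinitely often. Then: (a) for every $(d,\gamma)$, $Q_k(d,\gamma)\to Q^*(d,\gamma)$ with probability one as $k\to\infty$; (b) if $g_k(\cdot,d)\in\arg\min_{\gamma\in\mathcal{G}}Q_k(d,\gamma)$ is a greedy strategy (each agent plays $u^i_t=g_k(x^i_t,d_t)$), then $J_{n,\beta}(g_k)$ converges to $J_{n,\beta}(g^* )$, the optimal cost among deep-state-sharing strategies in which each agent's action is a deterministic function of $(x^i_t,d_t)$.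
   Context: Model: $n$ agents; $\mathcal{X},\mathcal{U},\mathcal{W}$ finite. $\mathcal{E}_n(\mathcal{S})$ denotes the probability vectors on a finite set $\mathcal{S}$ with entries in $\{0,\frac1n,\ldots,1\}$. $\mathfrak{D}_t(x,u)=\frac1n\sum_i\mathbb{1}\{x^i_t=x\}\mathbb{1}\{u^i_t=u\}$, deep state $d_t(x)=\frac1n\sum_i\mathbb{1}\{x^i_t=x\}$. Dynamics $x^i_{t+1}=f(x^i_t,u^i_t,\mathfrak{D}_t,w^i_t)$, noises i.i.d. across agents and time with pmf $P_W$, independent of the initial states. Per-step cost $c:\mathcal{X}\times\mathcal{U}\times\mathcal{E}_n(\mathcal{X}\times\mathcal{U})\to\mathbb{R}_{\ge0}$. $\mathcal{G}$ is the (finite) set of maps $\gamma:\mathcal{X}\to\mathcal{U}$. For $\gamma\in\mathcal{G}$, $\bar c(d,\gamma)=\mathbb{E}[\frac1n\sum_ic(x^i_t,\gamma(x^i_t),\mathfrak{D}_t)\mid d_t=d]$ and $\Pr(d'\mid d,\gamma)$ is the induced deep-state transition probability (both depend only on $d,\gamma$). $Q^*$ is the unique function on $\mathcal{E}_n(\mathcal{X})\times\mathcal{G}$ with $Q^*(d,\gamma)=\bar c(d,\gamma)+\beta\sum_{d'}\Pr(d'\mid d,\gamma)\min_{\gamma'\in\mathcal{G}}Q^*(d',\gamma')$. Cost of a strategy $g$: $J_{n,\beta}(g)=(1-\beta)\mathbb{E}^g[\frac1n\sum_i\sum_{t\ge1}\beta^{t-1}c(x^i_t,u^i_t,\mathf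rak{D}_t)]$.
   Formalization: The learning-rate conditions (divergent sum, summable squares) are required, almost surely, over the iterations k at which the pair is the current one, not over all k: with sums over all k the claim fails if visits are sparse. Rates may be random but must depend only on the past. *)

theory Defs
  imports "HOL-Probability.Probability"
begin

definition emp_set :: "nat \<Rightarrow> ('s::finite \<Rightarrow> real) set" where
  "emp_set n = {p. (\<forall>s. \<exists>m::nat. m \<le> n \<and> p s = real m / real n) \<and> sum p UNIV = 1}"

text \<open>A configuration of the n agents is a map xs :: nat => 'x, agent i < n having state xs i.\<close>
definition deep :: "nat \<Rightarrow> (nat \<Rightarrow> 'x) \<Rightarrow> ('x \<Rightarrow> real)" where
  "deep n xs = (\<lambda>x. real (card {i. i < n \<and> xs i = x}) / real n)"

definition empD :: "nat \<Rightarrow> (nat \<Rightarrow> 'x) \<Rightarrow> (nat \<Rightarrow> 'u) \<Rightarrow> ('x \<times> 'u \<Rightarrow> real)" where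
  "empD n xs us = (\<lambda>(x, u). real (card {i. i < n \<and> xs i = x \<and> us i = u}) / real n)"

definition config_of :: "nat \<Rightarrow> ('x \<Rightarrow> real) \<Rightarrow> (nat \<Rightarrow> 'x)" where
  "config_of n d = (SOME xs. deep n xs = d)"

definition noise_pmf :: "nat \<Rightarrow> 'w pmf \<Rightarrow> (nat \<Rightarrow> 'w) pmf" where
  "noise_pmf n PW = Pi_pmf {..<n} undefined (\<lambda>_. PW)"

definition trans_prob ::
  "nat \<Rightarrow> ('x \<Rightarrow> 'u \<Rightarrow> ('x \<times> 'u \<Rightarrow> real) \<Rightarrow> 'w \<Rightarrow> 'x) \<Rightarrow> 'w pmf
     \<Rightarrow> ('x \<Rightarrow> real) \<Rightarrow> ('x \<Rightarrow> 'u) \<Rightarrow> ('x \<Rightarrow> real) \<Rightarrow> real" where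
  "trans_prob n f PW d \<gamma> d' =
     (let xs = config_of n d; us = (\<lambda>i. \<gamma> (xs i)) in
      measure_pmf.prob (noise_pmf n PW)
        {w. deep n (\<lambda>i. f (xs i) (us i) (empD n xs us) (w i)) = d'})"

definition cbar ::
  "nat \<Rightarrow> ('x \<Rightarrow> 'u \<Rightarrow> ('x \<times> 'u \<Rightarrow> real) \<Rightarrow> real) \<Rightarrow> ('x \<Rightarrow> real) \<Rightarrow> ('x \<Rightarrow> 'u) \<Rightarrow> real" where
  "cbar n c d \<gamma> =
     (let xs = config_of n d; us = (\<lambda>i. \<gamma> (xs i)) in
      (\<Sum>i<n. c (xs i) (us i) (empD n xs us)) / real n)"

definition Qstar ::
  "nat \<Rightarrow> ('x::finite \<Rightarrow> 'u::finite \<Rightarrow> ('x \<times> 'u \<Rightarrow> real) \<Rightarrow> 'w \<Rightarrow> 'x) \<Rightarrow> 'w pmf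
     \<Rightarrow> ('x \<Rightarrow> 'u \<Rightarrow> ('x \<times> 'u \<Rightarrow> real) \<Rightarrow> real) \<Rightarrow> real
     \<Rightarrow> ('x \<Rightarrow> real) \<Rightarrow> ('x \<Rightarrow> 'u) \<Rightarrow> real" where
  "Qstar n f PW c \<beta> = (THE Q.
     (\<forall>d\<in>emp_set n. \<forall>\<gamma>. Q d \<gamma> = cbar n c d \<gamma>
        + \<beta> * (\<Sum>d'\<in>emp_set n. trans_prob n f PW d \<gamma> d' * Min (range (Q d'))))
     \<and> (\<forall>d. d \<notin> emp_set n \<longrightarrow> (\<forall>\<gamma>. Q d \<gamma> = 0)))"

text \<open>Given the sequence of visited pairs (ds k, gs k), the sampled next deep states ds' k
  and learning rates et k, the iterates Q_k (index 0 corresponds to Q_1 of the paper).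
  Only the currently visited pair is updated.\<close>
primrec qlearn ::
  "real \<Rightarrow> (('x \<Rightarrow> real) \<Rightarrow> ('x::finite \<Rightarrow> 'u::finite) \<Rightarrow> real)
     \<Rightarrow> (nat \<Rightarrow> 'x \<Rightarrow> real) \<Rightarrow> (nat \<Rightarrow> 'x \<Rightarrow> 'u) \<Rightarrow> (nat \<Rightarrow> 'x \<Rightarrow> real)
     \<Rightarrow> (nat \<Rightarrow> ('x \<Rightarrow> real) \<Rightarrow> ('x \<Rightarrow> 'u) \<Rightarrow> real)
     \<Rightarrow> nat \<Rightarrow> ('x \<Rightarrow> real) \<Rightarrow> ('x \<Rightarrow> 'u) \<Rightarrow> real" where
  "qlearn \<beta> cb ds gs ds' et 0 = (\<lambda>d \<gamma>. 0)"
| "qlearn \<beta> cb ds gs ds' et (Suc k) = (\<lambda>d \<gamma>.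
     if d = ds k \<and> \<gamma> = gs k
     then (1 - et k d \<gamma>) * qlearn \<beta> cb ds gs ds' et k d \<gamma>
          + et k d \<gamma> * (cb d \<gamma> + \<beta> * Min (range (qlearn \<beta> cb ds gs ds' et k (ds' k))))
     else qlearn \<beta> cb ds gs ds' et k d \<gamma>)"

definition hist_sets ::
  "'a measure \<Rightarrow> (nat \<Rightarrow> 'a \<Rightarrow> 'd) \<Rightarrow> (nat \<Rightarrow> 'a \<Rightarrow> 'g) \<Rightarrow> (nat \<Rightarrow> 'a \<Rightarrow> 'd)
     \<Rightarrow> (nat \<Rightarrow> 'a \<Rightarrow> 'd \<Rightarrow> 'g \<Rightarrow> real) \<Rightarrow> nat \<Rightarrow> 'a set set" where
  "hist_sets M D G D' eta k = sigma_sets (space M)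
     ((\<Union>j\<in>{..k}. {D j -` A \<inter> space M | A. True} \<union> {G j -` A \<inter> space M | A. True}
        \<union> (\<Union>d. \<Union>\<gamma>. {(\<lambda>\<omega>. eta j \<omega> d \<gamma>) -` B \<inter> space M | B. B \<in> sets borel}))
      \<union> (\<Union>j\<in>{..<k}. {D' j -` A \<inter> space M | A. True}))"

definition step_cfg ::
  "nat \<Rightarrow> ('x \<Rightarrow> 'u \<Rightarrow> ('x \<times> 'u \<Rightarrow> real) \<Rightarrow> 'w \<Rightarrow> 'x) \<Rightarrow> 'w pmf
     \<Rightarrow> ('x \<Rightarrow> ('x \<Rightarrow> real) \<Rightarrow> 'u) \<Rightarrow> (nat \<Rightarrow> 'x) \<Rightarrow> (nat \<Rightarrow> 'x) pmf" where
  "step_cfg n f PW g xs =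
     (let us = (\<lambda>i. g (xs i) (deep n xs)) in
      map_pmf (\<lambda>w i. if i < n then f (xs i) (us i) (empD n xs us) (w i) else undefined)
        (noise_pmf n PW))"

primrec cfg_dist ::
  "nat \<Rightarrow> ('x \<Rightarrow> 'u \<Rightarrow> ('x \<times> 'u \<Rightarrow> real) \<Rightarrow> 'w \<Rightarrow> 'x) \<Rightarrow> 'w pmf \<Rightarrow> (nat \<Rightarrow> 'x) pmf
     \<Rightarrow> ('x \<Rightarrow> ('x \<Rightarrow> real) \<Rightarrow> 'u) \<Rightarrow> nat \<Rightarrow> (nat \<Rightarrow> 'x) pmf" where
  "cfg_dist n f PW mu0 g 0 = mu0"
| "cfg_dist n f PW mu0 g (Suc t) = bind_pmf (cfg_dist n f PW mu0 g t) (step_cfg n f PW g)"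

definition stage_cost ::
  "nat \<Rightarrow> ('x \<Rightarrow> 'u \<Rightarrow> ('x \<times> 'u \<Rightarrow> real) \<Rightarrow> real) \<Rightarrow> ('x \<Rightarrow> ('x \<Rightarrow> real) \<Rightarrow> 'u)
     \<Rightarrow> (nat \<Rightarrow> 'x) \<Rightarrow> real" where
  "stage_cost n c g xs =
     (let us = (\<lambda>i. g (xs i) (deep n xs)) in (\<Sum>i<n. c (xs i) (us i) (empD n xs us)) / real n)"

text \<open>J_{n,beta}(g) = (1-beta) E^g [sum_t beta^t (1/n) sum_i c(x^i_t,u^i_t,D_t)]
  (time index shifted to start at 0), initial joint state law mu0.\<close>
definition Jcost ::
  "nat \<Rightarrow> ('x \<Rightarrow> 'u \<Rightarrow> ('x \<times> 'u \<Rightarrow> real) \<Rightarrow> 'w \<Rightarrow> 'x) \<Rightarrow> 'w pmf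
     \<Rightarrow> ('x \<Rightarrow> 'u \<Rightarrow> ('x \<times> 'u \<Rightarrow> real) \<Rightarrow> real) \<Rightarrow> real \<Rightarrow> (nat \<Rightarrow> 'x) pmf
     \<Rightarrow> ('x \<Rightarrow> ('x \<Rightarrow> real) \<Rightarrow> 'u) \<Rightarrow> real" where
  "Jcost n f PW c \<beta> mu0 g =
     (1 - \<beta>) * (\<Sum>t. \<beta> ^ t * measure_pmf.expectation (cfg_dist n f PW mu0 g t) (stage_cost n c g))"

definition Jopt ::
  "nat \<Rightarrow> ('x \<Rightarrow> 'u \<Rightarrow> ('x \<times> 'u \<Rightarrow> real) \<Rightarrow> 'w \<Rightarrow> 'x) \<Rightarrow> 'w pmf
     \<Rightarrow> ('x \<Rightarrow> 'u \<Rightarrow> ('x \<times> 'u \<Rightarrow> real) \<Rightarrow> real) \<Rightarrow> real \<Rightarrow> (nat \<Rightarrow> 'x) pmf \<Rightarrow> real" where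
  "Jopt n f PW c \<beta> mu0 = (INF g. Jcost n f PW c \<beta> mu0 g)"

end

theory Submission
  imports Defs "HOL-Combinatorics.Permutations"
begin

text \<open>The noise in the Q-iteration is a bounded martingale difference \<open>w\<^sub>k\<close>, because the cost depends
  on the visited pair alone and only the next deep state is random. Kolmogorov's inequality gives
  almost sure convergence of \<open>\<Sum>\<^sub>k \<eta>\<^sub>k w\<^sub>k\<close> when \<open>\<Sum>\<^sub>k \<eta>\<^sub>k\<^sup>2 < \<infinity>\<close>, so that along almost every path the
  averaged noise vanishes and the remaining recursion is contracted asynchronously towards \<open>Q\<^sup>*\<close>.
  By exchangeability of the agents the deep state is a controlled Markov chain whose Bellman
  function is \<open>Q\<^sup>*\<close>, so laws greedy for \<open>Q\<^sup>*\<close> are optimal; as there are finitely many pairs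
  \<open>(d, \<gamma>)\<close>, a greedy law for \<open>Q\<^sub>k\<close> is eventually greedy for \<open>Q\<^sup>*\<close>.\<close>

section \<open>Damped recursions\<close>

text \<open>Which pair is visited may depend on the whole past, so the step size seen by a fixed
  pair is random and its square sum has no deterministic bound. The visit indicator is therefore
  absorbed into the step size: every pair then obeys one recursion at all times, with coefficients
  known before the next deep state is drawn. Convex updates keep the iterates, hence the noise,
  bounded in advance, so no separate stability argument arises. Probability serves to make finitely
  many noise series converge; what follows is a deterministic statement about one path. There the
  contraction acts in the sup norm over all pairs while step sizes differ between pairs, so a common
  bound is shrunk by a fixed factor in each round, without controlling how long a round lasts. For
  the costs, one performance difference formula yields both the lower bound for all strategies and
  its attainment by greedy ones.\<close>

lemma nonneg_not_summable_partial_sums: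
  fixes a :: "nat \<Rightarrow> real"
  assumes "\<And>k. 0 \<le> a k" "\<not> summable a"
  shows "filterlim (\<lambda>N. \<Sum>k<N. a k) at_top sequentially"
  unfolding filterlim_at_top_ge[where c=0]
proof (intro allI impI)
  fix R :: real
  have "\<exists>N. R < (\<Sum>k<N. a k)"
    using summableI_nonneg_bounded[of a R] assms by (force simp: not_le[symmetric])
  then obtain N where N: "R < (\<Sum>k<N. a k)" by blast
  have "R \<le> (\<Sum>k<m. a k)" if "N \<le> m" for m
    using sum_mono2[of "{..<m}" "{..<N}" a] that N assms(1) by force
  then show "\<forall>\<^sub>F m in sequentially. R \<le> (\<Sum>k<m. a k)"
    by (auto simp: eventually_sequentially)
qed

text \<open>Past the time from which the step holds, the positive part of the excess over
  \<open>B\<close> is multiplied by at most \<open>1 - a k \<le> exp (- a k)\<close>, and divergence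
  of the sum drives the product of these factors to 0.\<close>

lemma damped_recursion_eventually_le:
  fixes x a :: "nat \<Rightarrow> real"
  assumes a: "\<And>k. 0 \<le> a k" "\<And>k. a k \<le> 1" and div: "\<not> summable a"
    and step: "\<forall>\<^sub>F k in sequentially. x (Suc k) \<le> (1 - a k) * x k + a k * B"
    and "0 < \<epsilon>"
  shows "\<forall>\<^sub>F k in sequentially. x k \<le> B + \<epsilon>"
proof -
  obtain K where K: "\<And>k. k \<ge> K \<Longrightarrow> x (Suc k) \<le> (1 - a k) * x k + a k * B"
    using step by (auto simp: eventually_sequentially)
  \<comment> \<open>Truncation at 0 covers a start below \<open>B\<close>: replacing the factor
    \<open>1 - a k\<close> by the larger \<open>exp (- a k)\<close> is monotone only for a
    nonnegative quantity.\<close>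
  define z where "z = max 0 (x K - B)"
  have z: "0 \<le> z" by (simp add: z_def)
  have bnd: "x (j + K) - B \<le> z * exp (- (\<Sum>i<j. a (i + K)))" for j
  proof (induction j)
    case 0
    show ?case by (simp add: z_def)
  next
    case (Suc j)
    have "x (Suc j + K) - B \<le> (1 - a (j + K)) * (x (j + K) - B)"
      using K[of "j + K"] by (simp add: algebra_simps)
    also have "\<dots> \<le> (1 - a (j + K)) * (z * exp (- (\<Sum>i<j. a (i + K))))"
      using Suc a by (intro mult_left_mono) auto
    also have "\<dots> \<le> exp (- a (j + K)) * (z * exp (- (\<Sum>i<j. a (i + K))))"
      using exp_ge_add_one_self[of "- a (j + K)"] z by (intro mult_right_mono) auto
    also have "\<dots> = z * exp (- (\<Sum>i<Suc j. a (i + K)))"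
      by (simp add: exp_add[symmetric])
    finally show ?case .
  qed
  have "filterlim (\<lambda>j. \<Sum>i<j. a (i + K)) at_top sequentially"
    using nonneg_not_summable_partial_sums[of "\<lambda>i. a (i + K)"] a div by simp
  then have "(\<lambda>j. exp (- (\<Sum>i<j. a (i + K)))) \<longlonglongrightarrow> 0"
    by (intro filterlim_compose[OF exp_at_bot] filterlim_compose[OF filterlim_uminus_at_bot_at_top])
  then have "(\<lambda>j. z * exp (- (\<Sum>i<j. a (i + K)))) \<longlonglongrightarrow> 0"
    by (rule tendsto_mult_right_zero)
  then have "\<forall>\<^sub>F j in sequentially. z * exp (- (\<Sum>i<j. a (i + K))) < \<epsilon>"
    using \<open>0 < \<epsilon>\<close> by (rule order_tendstoD)
  then have "\<forall>\<^sub>F j in sequentially. x (j + K) \<le> B + \<epsilon>"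
    by eventually_elim (use bnd in \<open>smt (verit)\<close>)
  then show ?thesis
    by (subst (asm) eventually_sequentially_seg)
qed

lemma damped_recursion_eventually_abs_le:
  fixes x a e :: "nat \<Rightarrow> real"
  assumes a: "\<And>k. 0 \<le> a k" "\<And>k. a k \<le> 1" and div: "\<not> summable a"
    and step: "\<And>k. x (Suc k) = (1 - a k) * x k + a k * e k"
    and e: "\<forall>\<^sub>F k in sequentially. \<bar>e k\<bar> \<le> B"
    and "0 < \<epsilon>"
  shows "\<forall>\<^sub>F k in sequentially. \<bar>x k\<bar> \<le> B + \<epsilon>"
proof -
  have "\<forall>\<^sub>F k in sequentially. x k \<le> B + \<epsilon>"
    using a div
  proof (rule damped_recursion_eventually_le)
    show "\<forall>\<^sub>F k in sequentially. x (Suc k) \<le> (1 - a k) * x k + a k * B"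
      using e by eventually_elim (use a in \<open>auto simp: step intro!: mult_left_mono\<close>)
  qed fact
  moreover have "\<forall>\<^sub>F k in sequentially. - x k \<le> B + \<epsilon>"
    using a div
  proof (rule damped_recursion_eventually_le)
    show "\<forall>\<^sub>F k in sequentially. - x (Suc k) \<le> (1 - a k) * - x k + a k * B"
      using e
    proof eventually_elim
      case (elim k)
      have "a k * - e k \<le> a k * B" using a elim by (intro mult_left_mono) auto
      then show ?case by (simp add: step algebra_simps)
    qed
  qed fact
  ultimately show ?thesis by eventually_elim auto
qed

lemma damped_average_tendsto:
  fixes x a e :: "nat \<Rightarrow> real"
  assumes a: "\<And>k. 0 \<le> a k" "\<And>k. a k \<le> 1" and div: "\<not> summable a"
    and step: "\<And>k. x (Suc k) = (1 - a k) * x k + a k * e k"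
    and e: "e \<longlonglongrightarrow> l"
  shows "x \<longlonglongrightarrow> l"
proof (rule LIMSEQ_I)
  fix r :: real assume "0 < r"
  have "\<forall>\<^sub>F k in sequentially. \<bar>x k - l\<bar> \<le> r / 3 + r / 3"
    using a div
  proof (rule damped_recursion_eventually_abs_le)
    \<comment> \<open>Centering at \<open>l\<close> preserves the recursion because the weights
      \<open>1 - a k\<close> and \<open>a k\<close> add up to 1.\<close>
    show "x (Suc k) - l = (1 - a k) * (x k - l) + a k * (e k - l)" for k
      by (simp add: step algebra_simps)
    show "\<forall>\<^sub>F k in sequentially. \<bar>e k - l\<bar> \<le> r / 3"
      using tendstoD[OF e, of "r / 3"] \<open>0 < r\<close> by (auto simp: dist_real_def elim!: eventually_mono)
  qed (use \<open>0 < r\<close> in auto)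
  then have "\<forall>\<^sub>F k in sequentially. norm (x k - l) < r"
    by eventually_elim (use \<open>0 < r\<close> in auto)
  then show "\<exists>no. \<forall>n\<ge>no. norm (x n - l) < r"
    by (simp add: eventually_sequentially)
qed

text \<open>Subtracting the partial sums of the noise turns the recursion into a weighted average
  of the negated partial sums, which converge.\<close>

lemma damped_noise_tendsto_zero:
  fixes x a w :: "nat \<Rightarrow> real"
  assumes a: "\<And>k. 0 \<le> a k" "\<And>k. a k \<le> 1" and div: "\<not> summable a"
    and step: "\<And>k. x (Suc k) = (1 - a k) * x k + a k * w k"
    and w: "summable (\<lambda>k. a k * w k)"
  shows "x \<longlonglongrightarrow> 0"
proof -
  define S where "S = (\<lambda>N. \<Sum>k<N. a k * w k)"
  have S: "S \<longlonglongrightarrow> (\<Sum>k. a k * w k)"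
    unfolding S_def using w by (rule summable_LIMSEQ)
  have "(\<lambda>k. x k - S k) \<longlonglongrightarrow> - (\<Sum>k. a k * w k)"
    using a div
  proof (rule damped_average_tendsto)
    show "x (Suc k) - S (Suc k) = (1 - a k) * (x k - S k) + a k * - S k" for k
      by (simp add: step S_def algebra_simps)
    show "(\<lambda>k. - S k) \<longlonglongrightarrow> - (\<Sum>k. a k * w k)"
      using S by (rule tendsto_minus)
  qed
  from tendsto_add[OF this S] show ?thesis by simp
qed

text \<open>Once all components are bounded by \<open>B\<close>, removing the noise shows that they are
  eventually bounded by \<open>\<rho> B\<close> for any \<open>\<rho>\<close> above the contraction factor; iterate.\<close>

lemma async_contraction_tendsto_zero:
  fixes q a e w :: "nat \<Rightarrow> 's \<Rightarrow> real"
  assumes fin: "finite I" and \<beta>: "0 \<le> \<beta>" "\<beta> < 1"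
    and a: "\<And>k s. s \<in> I \<Longrightarrow> 0 \<le> a k s" "\<And>k s. s \<in> I \<Longrightarrow> a k s \<le> 1"
    and div: "\<And>s. s \<in> I \<Longrightarrow> \<not> summable (\<lambda>k. a k s)"
    and step: "\<And>k s. s \<in> I \<Longrightarrow> q (Suc k) s = (1 - a k s) * q k s + a k s * (e k s + w k s)"
    and contr: "\<And>k s B. s \<in> I \<Longrightarrow> (\<And>s'. s' \<in> I \<Longrightarrow> \<bar>q k s'\<bar> \<le> B) \<Longrightarrow> \<bar>e k s\<bar> \<le> \<beta> * B"
    and w: "\<And>s. s \<in> I \<Longrightarrow> summable (\<lambda>k. a k s * w k s)"
    and bdd: "\<And>k s. s \<in> I \<Longrightarrow> \<bar>q k s\<bar> \<le> B0"
    and s: "s \<in> I"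
  shows "(\<lambda>k. q k s) \<longlonglongrightarrow> 0"
proof -
  \<comment> \<open>\<open>W s\<close> is the response of the recursion to the noise alone, started
    at 0; by linearity \<open>q - W\<close> is driven only by the contracting term
    \<open>e\<close>.\<close>
  define W where "W = (\<lambda>s. rec_nat 0 (\<lambda>k x. (1 - a k s) * x + a k s * w k s))"
  have W_Suc: "W s (Suc k) = (1 - a k s) * W s k + a k s * w k s" for s k
    by (simp add: W_def)
  have W: "W s \<longlonglongrightarrow> 0" if "s \<in> I" for s
    using a[OF that] div[OF that] W_Suc w[OF that] by (rule damped_noise_tendsto_zero)
  \<comment> \<open>Any factor strictly between \<open>\<beta>\<close> and 1 works; the midpoint
    leaves a positive slack \<open>\<rho> - \<beta>\<close> to absorb the errors of one
    round.\<close>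
  define \<rho> where "\<rho> = (1 + \<beta>) / 2"
  have \<rho>: "0 < \<rho>" "\<rho> < 1" "\<beta> < \<rho>" using \<beta> by (auto simp: \<rho>_def)
  \<comment> \<open>The maximum with 1 makes the bound strictly positive, so that the tolerance
    \<open>\<epsilon>\<close> of each round is positive too.\<close>
  define C where "C = max 1 B0"
  have C: "0 < C" by (simp add: C_def)
  have ev: "\<forall>\<^sub>F k in sequentially. \<forall>s\<in>I. \<bar>q k s\<bar> \<le> C * \<rho> ^ m" for m
  proof (induction m)
    case 0
    show ?case using bdd by (auto simp: C_def le_max_iff_disj)
  next
    case (Suc m)
    define B where "B = C * \<rho> ^ m"
    have B: "0 < B" using C \<rho> by (simp add: B_def)
    \<comment> \<open>Half of the slack each: one \<open>\<epsilon>\<close> for the damped recursion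
      of \<open>q - W\<close>, one for \<open>W\<close>, so that
      \<open>\<beta> * B + 2 * \<epsilon> = \<rho> * B\<close>.\<close>
    define \<epsilon> where "\<epsilon> = (\<rho> - \<beta>) * B / 2"
    have \<epsilon>: "0 < \<epsilon>" using B \<rho> by (simp add: \<epsilon>_def)
    have "\<forall>\<^sub>F k in sequentially. \<bar>q k s\<bar> \<le> C * \<rho> ^ Suc m" if s: "s \<in> I" for s
    proof -
      have "\<forall>\<^sub>F k in sequentially. \<bar>q k s - W s k\<bar> \<le> \<beta> * B + \<epsilon>"
        using a[OF s] div[OF s]
      proof (rule damped_recursion_eventually_abs_le)
        show "q (Suc k) s - W s (Suc k) = (1 - a k s) * (q k s - W s k) + a k s * e k s" for k
          by (simp add: step[OF s] W_Suc algebra_simps)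
        show "\<forall>\<^sub>F k in sequentially. \<bar>e k s\<bar> \<le> \<beta> * B"
          using Suc by eventually_elim (use contr[OF s] in \<open>auto simp: B_def\<close>)
      qed (fact \<epsilon>)
      moreover have "\<forall>\<^sub>F k in sequentially. \<bar>W s k\<bar> \<le> \<epsilon>"
        using tendstoD[OF W[OF s] \<epsilon>] by (auto elim!: eventually_mono)
      ultimately show ?thesis
      proof eventually_elim
        case (elim k)
        have "\<bar>q k s\<bar> \<le> \<beta> * B + \<epsilon> + \<epsilon>" using elim by linarith
        also have "\<dots> = \<rho> * B" by (simp add: \<epsilon>_def field_simps)
        finally show ?case by (simp add: B_def mult_ac)
      qed
    qed
    \<comment> \<open>Finiteness of \<open>I\<close> merges the separate waiting times of the
      components, since \<open>contr\<close> asks for a bound on all of them at the same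
      time.\<close>
    then show ?case using fin by (simp add: eventually_ball_finite)
  qed
  show ?thesis
  proof (rule LIMSEQ_I)
    fix r :: real assume "0 < r"
    have "(\<lambda>m. C * \<rho> ^ m) \<longlonglongrightarrow> 0"
      using \<rho> by (intro tendsto_mult_right_zero LIMSEQ_power_zero) auto
    then have "\<forall>\<^sub>F m in sequentially. C * \<rho> ^ m < r"
      using \<open>0 < r\<close> by (rule order_tendstoD)
    then obtain m where "C * \<rho> ^ m < r" by (auto simp: eventually_sequentially)
    with ev[of m] s have "\<forall>\<^sub>F k in sequentially. norm (q k s - 0) < r"
      by (auto elim!: eventually_mono)
    then show "\<exists>no. \<forall>n\<ge>no. norm (q n s - 0) < r"
      by (simp add: eventually_sequentially)
  qed
qed

section \<open>Square-summable martingale differences\<close>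

text \<open>The condition that \<open>w k\<close> has conditional mean zero given \<open>F k\<close>
  is stated by testing against bounded \<open>F k\<close>-measurable functions, the form in which it
  kills the cross terms of second moments.\<close>

locale martingale_differences = prob_space M for M :: "'a measure" +
  fixes F :: "nat \<Rightarrow> 'a measure" and w :: "nat \<Rightarrow> 'a \<Rightarrow> real" and C :: real
  assumes subalg: "\<And>k. subalgebra M (F k)"
    and filtration: "\<And>k. sets (F k) \<subseteq> sets (F (Suc k))"
    and adapted: "\<And>k. w k \<in> borel_measurable (F (Suc k))"
    and bounded: "\<And>k \<omega>. \<omega> \<in> space M \<Longrightarrow> \<bar>w k \<omega>\<bar> \<le> C"
    and orthogonal: "\<And>k X B. X \<in> borel_measurable (F k) \<Longrightarrow>
      (\<And>\<omega>. \<omega> \<in> space M \<Longrightarrow> \<bar>X \<omega>\<bar> \<le> B) \<Longrightarrow> (\<integral>\<omega>. X \<omega> * w k \<omega> \<partial>M) = 0"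
begin

lemma subalgebra_filtration: "i \<le> j \<Longrightarrow> subalgebra (F j) (F i)"
  using lift_Suc_mono_le[of "\<lambda>k. sets (F k)" i j] filtration subalg
  by (auto simp: subalgebra_def)

lemma measurable_filtration_mono: "X \<in> borel_measurable (F i) \<Longrightarrow> i \<le> j \<Longrightarrow> X \<in> borel_measurable (F j)"
  using measurable_from_subalg subalgebra_filtration by blast

lemma measurable_filtration_M: "X \<in> borel_measurable (F i) \<Longrightarrow> X \<in> borel_measurable M"
  using measurable_from_subalg subalg by blast

lemma C_nonneg: "0 \<le> C"
proof -
  obtain \<omega> where "\<omega> \<in> space M" using not_empty by blast
  from bounded[OF this, of 0] show ?thesis by linarith
qed

context
  fixes a :: "nat \<Rightarrow> 'a \<Rightarrow> real"
  assumes predictable: "\<And>k. a k \<in> borel_measurable (F k)"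
    and a_le_1: "\<And>k \<omega>. \<omega> \<in> space M \<Longrightarrow> \<bar>a k \<omega>\<bar> \<le> 1"
begin

lemma partial_sum_measurable:
  "N \<le> N' \<Longrightarrow> (\<lambda>\<omega>. \<Sum>k\<in>{m..<N}. a k \<omega> * w k \<omega>) \<in> borel_measurable (F N')"
  by (intro borel_measurable_sum borel_measurable_times)
    (auto intro: measurable_filtration_mono[OF predictable] measurable_filtration_mono[OF adapted])

lemma partial_sum_bounded:
  assumes "\<omega> \<in> space M"
  shows "\<bar>\<Sum>k\<in>{m..<N}. a k \<omega> * w k \<omega>\<bar> \<le> real (N - m) * C"
proof -
  have "\<bar>\<Sum>k\<in>{m..<N}. a k \<omega> * w k \<omega>\<bar> \<le> (\<Sum>k\<in>{m..<N}. \<bar>a k \<omega>\<bar> * \<bar>w k \<omega>\<bar>)"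
    by (simp flip: abs_mult)
  also have "\<dots> \<le> (\<Sum>k\<in>{m..<N}. 1 * C)"
    using a_le_1[OF assms] bounded[OF assms] by (intro sum_mono mult_mono) auto
  finally show ?thesis by simp
qed

lemma integrable_predictable_sq: "integrable M (\<lambda>\<omega>. (a k \<omega>)\<^sup>2)"
proof (rule integrable_const_bound[where B=1])
  show "AE \<omega> in M. norm ((a k \<omega>)\<^sup>2) \<le> 1"
    using a_le_1 by (intro AE_I2) (simp add: abs_square_le_1)
qed (use measurable_filtration_M[OF predictable] in measurable)

text \<open>When the square of the next partial sum is expanded, the cross term is
  \<open>w N\<close> times a bounded function of the past and integrates to 0, so only the diagonal
  terms accumulate.\<close>

lemma partial_sum_sq:
  assumes "m \<le> N"
  shows "integrable M (\<lambda>\<omega>. (\<Sum>k\<in>{m..<N}. a k \<omega> * w k \<omega>)\<^sup>2)"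
    and "(\<integral>\<omega>. (\<Sum>k\<in>{m..<N}. a k \<omega> * w k \<omega>)\<^sup>2 \<partial>M) \<le> C\<^sup>2 * (\<Sum>k\<in>{m..<N}. \<integral>\<omega>. (a k \<omega>)\<^sup>2 \<partial>M)"
proof -
  have w_M[measurable]: "w k \<in> borel_measurable M" for k
    by (rule measurable_filtration_M[OF adapted])
  have a_M[measurable]: "a k \<in> borel_measurable M" for k
    by (rule measurable_filtration_M[OF predictable])
  have bdd_int: "integrable M X" if "X \<in> borel_measurable M" "\<And>\<omega>. \<omega> \<in> space M \<Longrightarrow> \<bar>X \<omega>\<bar> \<le> K"
    for X :: "'a \<Rightarrow> real" and K
    using that by (intro integrable_const_bound[where B=K]) auto
  show int: "integrable M (\<lambda>\<omega>. (\<Sum>k\<in>{m..<N}. a k \<omega> * w k \<omega>)\<^sup>2)" for N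
  proof (rule bdd_int[of _ "(real (N - m) * C)\<^sup>2"])
    show "\<bar>(\<Sum>k\<in>{m..<N}. a k \<omega> * w k \<omega>)\<^sup>2\<bar> \<le> (real (N - m) * C)\<^sup>2" if "\<omega> \<in> space M" for \<omega>
      using power_mono[OF partial_sum_bounded[OF that, of m N] abs_ge_zero, of 2] by simp
  qed measurable
  show "(\<integral>\<omega>. (\<Sum>k\<in>{m..<N}. a k \<omega> * w k \<omega>)\<^sup>2 \<partial>M) \<le> C\<^sup>2 * (\<Sum>k\<in>{m..<N}. \<integral>\<omega>. (a k \<omega>)\<^sup>2 \<partial>M)"
    using assms
  proof (induction N rule: dec_induct)
    case (step N)
    define S where "S = (\<lambda>\<omega>. \<Sum>k\<in>{m..<N}. a k \<omega> * w k \<omega>)"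
    define X where "X = (\<lambda>\<omega>. 2 * S \<omega> * a N \<omega>)"
    have S_F: "S \<in> borel_measurable (F N)"
      unfolding S_def by (rule partial_sum_measurable) simp
    have [measurable]: "S \<in> borel_measurable M"
      by (rule measurable_filtration_M[OF S_F])
    have X_F: "X \<in> borel_measurable (F N)"
      unfolding X_def by (intro borel_measurable_times borel_measurable_const S_F predictable)
    have [measurable]: "X \<in> borel_measurable M"
      by (rule measurable_filtration_M[OF X_F])
    have S_bdd: "\<bar>S \<omega>\<bar> \<le> real (N - m) * C" if "\<omega> \<in> space M" for \<omega>
      unfolding S_def using partial_sum_bounded[OF that] .
    have X_bdd: "\<bar>X \<omega>\<bar> \<le> 2 * (real (N - m) * C)" if "\<omega> \<in> space M" for \<omega>
      using mult_mono[OF S_bdd[OF that] a_le_1[OF that, of N]] C_nonneg by (simp add: X_def abs_mult)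
    have Xw_int: "integrable M (\<lambda>\<omega>. X \<omega> * w N \<omega>)"
      using mult_mono[OF X_bdd bounded[of _ N]] C_nonneg
      by (intro bdd_int[of _ "2 * (real (N - m) * C) * C"]) (auto simp: abs_mult)
    have aw: "(a N \<omega> * w N \<omega>)\<^sup>2 \<le> C\<^sup>2 * (a N \<omega>)\<^sup>2" if "\<omega> \<in> space M" for \<omega>
      using mult_right_mono[OF power_mono[OF bounded[OF that, of N], of 2], of "(a N \<omega>)\<^sup>2"]
      by (simp add: power_mult_distrib mult.commute)
    have aw_int: "integrable M (\<lambda>\<omega>. (a N \<omega> * w N \<omega>)\<^sup>2)"
      by (rule Bochner_Integration.integrable_bound[where f="\<lambda>\<omega>. C\<^sup>2 * (a N \<omega>)\<^sup>2"])
        (use aw integrable_predictable_sq in auto)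
    have "(\<Sum>k\<in>{m..<Suc N}. a k \<omega> * w k \<omega>)\<^sup>2 = (S \<omega>)\<^sup>2 + X \<omega> * w N \<omega> + (a N \<omega> * w N \<omega>)\<^sup>2" for \<omega>
      using step.hyps by (simp add: S_def X_def power2_eq_square algebra_simps)
    then have "(\<integral>\<omega>. (\<Sum>k\<in>{m..<Suc N}. a k \<omega> * w k \<omega>)\<^sup>2 \<partial>M)
        = (\<integral>\<omega>. (S \<omega>)\<^sup>2 \<partial>M) + (\<integral>\<omega>. X \<omega> * w N \<omega> \<partial>M) + (\<integral>\<omega>. (a N \<omega> * w N \<omega>)\<^sup>2 \<partial>M)"
      using int[of N] Xw_int aw_int by (simp add: S_def)
    also have "(\<integral>\<omega>. X \<omega> * w N \<omega> \<partial>M) = 0"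
      using X_F X_bdd by (rule orthogonal)
    also have "(\<integral>\<omega>. (a N \<omega> * w N \<omega>)\<^sup>2 \<partial>M) \<le> (\<integral>\<omega>. C\<^sup>2 * (a N \<omega>)\<^sup>2 \<partial>M)"
      using aw aw_int integrable_predictable_sq by (intro integral_mono) auto
    finally show ?case
      using step by (simp add: S_def distrib_left)
  qed simp
qed

end

text \<open>Kolmogorov's inequality: freezing the coefficients when the partial sums leave
  \<open>(-\<epsilon>, \<epsilon>)\<close> keeps them predictable and reduces the maximum to the terminal value.\<close>

lemma maximal_inequality:
  fixes a :: "nat \<Rightarrow> 'a \<Rightarrow> real"
  assumes predictable: "\<And>k. a k \<in> borel_measurable (F k)"
    and a_le_1: "\<And>k \<omega>. \<omega> \<in> space M \<Longrightarrow> \<bar>a k \<omega>\<bar> \<le> 1"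
    and "m \<le> N" "0 < \<epsilon>"
  shows "prob {\<omega> \<in> space M. \<exists>j\<in>{m..N}. \<epsilon> \<le> \<bar>\<Sum>k\<in>{m..<j}. a k \<omega> * w k \<omega>\<bar>}
    \<le> C\<^sup>2 * (\<Sum>k\<in>{m..<N}. \<integral>\<omega>. (a k \<omega>)\<^sup>2 \<partial>M) / \<epsilon>\<^sup>2"
proof -
  define S where "S = (\<lambda>j \<omega>. \<Sum>k\<in>{m..<j}. a k \<omega> * w k \<omega>)"
  \<comment> \<open>The indicator at \<open>k\<close> looks only at \<open>S j\<close> with
    \<open>j \<le> k\<close>, which involves \<open>w i\<close> for \<open>i < k\<close>; so
    \<open>b k\<close> is still known at time \<open>k\<close>.\<close>
  define b where "b = (\<lambda>k \<omega>. a k \<omega> * (if \<forall>j\<in>{m..k}. \<bar>S j \<omega>\<bar> < \<epsilon> then 1 else 0))"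
  have S_F: "S j \<in> borel_measurable (F k)" if "j \<le> k" for j k
    unfolding S_def using predictable a_le_1 that by (rule partial_sum_measurable)
  have b_F: "b k \<in> borel_measurable (F k)" for k
  proof -
    have [measurable]: "a k \<in> borel_measurable (F k)" by (rule predictable)
    have "{\<omega> \<in> space (F k). \<bar>S j \<omega>\<bar> < \<epsilon>} \<in> sets (F k)" if "j \<in> {m..k}" for j
    proof -
      have [measurable]: "S j \<in> borel_measurable (F k)" using that S_F by simp
      show ?thesis by measurable
    qed
    then have [measurable]: "Measurable.pred (F k) (\<lambda>\<omega>. \<forall>j\<in>{m..k}. \<bar>S j \<omega>\<bar> < \<epsilon>)"
      by (intro pred_intros_finite) (auto simp: pred_def)
    show ?thesis unfolding b_def by measurable
  qed
  have b_sq: "(b k \<omega>)\<^sup>2 \<le> (a k \<omega>)\<^sup>2" for k \<omega> by (simp add: b_def)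
  have b_le_1: "\<bar>b k \<omega>\<bar> \<le> 1" if "\<omega> \<in> space M" for k \<omega> using a_le_1[OF that] by (simp add: b_def)
  define T where "T = (\<lambda>\<omega>. \<Sum>k\<in>{m..<N}. b k \<omega> * w k \<omega>)"
  have T_int: "integrable M (\<lambda>\<omega>. (T \<omega>)\<^sup>2)"
    unfolding T_def using b_F b_le_1 \<open>m \<le> N\<close> by (rule partial_sum_sq)
  have [measurable]: "T \<in> borel_measurable M"
    unfolding T_def using partial_sum_measurable[of b N N m] b_F b_le_1 measurable_filtration_M by blast
  have "\<epsilon>\<^sup>2 \<le> (T \<omega>)\<^sup>2" if "\<exists>i\<in>{m..N}. \<epsilon> \<le> \<bar>S i \<omega>\<bar>" for \<omega>
  proof -
    \<comment> \<open>\<open>j\<close> is the first exit time, taken over an unbounded range; the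
      exit \<open>i\<close> supplied by the assumption shows \<open>j \<le> N\<close>, and all
      coefficients from \<open>j\<close> on are frozen, whence
      \<open>T \<omega> = S j \<omega>\<close>.\<close>
    define j where "j = (LEAST j. m \<le> j \<and> \<epsilon> \<le> \<bar>S j \<omega>\<bar>)"
    have ex: "\<exists>j. m \<le> j \<and> \<epsilon> \<le> \<bar>S j \<omega>\<bar>" using that by auto
    have j: "m \<le> j" "\<epsilon> \<le> \<bar>S j \<omega>\<bar>"
      using LeastI_ex[OF ex] by (auto simp: j_def)
    have less: "\<bar>S i \<omega>\<bar> < \<epsilon>" if "m \<le> i" "i < j" for i
      using not_less_Least[of i "\<lambda>j. m \<le> j \<and> \<epsilon> \<le> \<bar>S j \<omega>\<bar>"] that by (auto simp: j_def)
    from that obtain i where i: "i \<in> {m..N}" "\<epsilon> \<le> \<bar>S i \<omega>\<bar>" by blast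
    have "j \<le> i" unfolding j_def using i by (intro Least_le) auto
    with i have "j \<le> N" by simp
    have "b k \<omega> = (if k < j then a k \<omega> else 0)" if "k \<in> {m..<N}" for k
    proof (cases "k < j")
      case False
      then have "\<not> (\<forall>i\<in>{m..k}. \<bar>S i \<omega>\<bar> < \<epsilon>)" using j by (auto intro!: bexI[of _ j])
      then show ?thesis unfolding b_def using False by (simp only: if_False)
    qed (use less in \<open>auto simp: b_def\<close>)
    then have "T \<omega> = (\<Sum>k\<in>{m..<N}. if k < j then a k \<omega> * w k \<omega> else 0)"
      unfolding T_def by (intro sum.cong) auto
    also have "\<dots> = S j \<omega>"
      unfolding S_def using \<open>j \<le> N\<close> by (intro sum.mono_neutral_cong_right) auto
    finally have "\<epsilon> \<le> \<bar>T \<omega>\<bar>" using j by simp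
    then have "\<epsilon>\<^sup>2 \<le> \<bar>T \<omega>\<bar>\<^sup>2" using \<open>0 < \<epsilon>\<close> by (intro power_mono) auto
    then show ?thesis by simp
  qed
  then have "prob {\<omega> \<in> space M. \<exists>j\<in>{m..N}. \<epsilon> \<le> \<bar>S j \<omega>\<bar>} \<le> prob {\<omega> \<in> space M. \<epsilon>\<^sup>2 \<le> (T \<omega>)\<^sup>2}"
    by (intro finite_measure_mono) auto
  also have "\<dots> \<le> (\<integral>\<omega>. (T \<omega>)\<^sup>2 \<partial>M) / \<epsilon>\<^sup>2"
    using integral_Markov_inequality_measure[OF T_int, of "{}" "\<epsilon>\<^sup>2"] \<open>0 < \<epsilon>\<close> by auto
  also have "(\<integral>\<omega>. (T \<omega>)\<^sup>2 \<partial>M) \<le> C\<^sup>2 * (\<Sum>k\<in>{m..<N}. \<integral>\<omega>. (b k \<omega>)\<^sup>2 \<partial>M)"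
    unfolding T_def using b_F b_le_1 \<open>m \<le> N\<close> by (rule partial_sum_sq)
  also have "(\<Sum>k\<in>{m..<N}. \<integral>\<omega>. (b k \<omega>)\<^sup>2 \<partial>M) \<le> (\<Sum>k\<in>{m..<N}. \<integral>\<omega>. (a k \<omega>)\<^sup>2 \<partial>M)"
    using integrable_predictable_sq[of b, OF b_F b_le_1] integrable_predictable_sq[of a, OF predictable a_le_1] b_sq
    by (intro sum_mono integral_mono) auto
  finally show ?thesis
    by (simp add: S_def divide_right_mono mult_left_mono)
qed

text \<open>This is the Cauchy criterion: the probability that the sums started at \<open>m\<close>
  ever leave \<open>(-\<epsilon>, \<epsilon>)\<close> is controlled by the tail of a convergent
  series of second moments, so almost surely some start \<open>m\<close> never leaves.\<close>

lemma AE_summable_L2: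
  fixes a :: "nat \<Rightarrow> 'a \<Rightarrow> real"
  assumes predictable: "\<And>k. a k \<in> borel_measurable (F k)"
    and a_le_1: "\<And>k \<omega>. \<omega> \<in> space M \<Longrightarrow> \<bar>a k \<omega>\<bar> \<le> 1"
    and L2: "summable (\<lambda>k. \<integral>\<omega>. (a k \<omega>)\<^sup>2 \<partial>M)"
  shows "AE \<omega> in M. summable (\<lambda>k. a k \<omega> * w k \<omega>)"
proof -
  define S where "S = (\<lambda>m j \<omega>. \<Sum>k\<in>{m..<j}. a k \<omega> * w k \<omega>)"
  have [measurable]: "S m j \<in> borel_measurable M" for m j
    unfolding S_def using partial_sum_measurable[of a j j m] predictable a_le_1 measurable_filtration_M by blast
  define v where "v = (\<lambda>k. \<integral>\<omega>. (a k \<omega>)\<^sup>2 \<partial>M)"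
  have v: "0 \<le> v k" for k by (simp add: v_def)
  have "AE \<omega> in M. \<exists>m. \<forall>j\<ge>m. \<bar>S m j \<omega>\<bar> < \<epsilon>" if "0 < \<epsilon>" for \<epsilon>
  proof -
    define Bad where "Bad = (\<lambda>m. {\<omega> \<in> space M. \<exists>j\<ge>m. \<epsilon> \<le> \<bar>S m j \<omega>\<bar>})"
    have Bad_sets: "Bad m \<in> sets M" for m unfolding Bad_def by measurable
    have Bad_le: "prob (Bad m) \<le> C\<^sup>2 * (\<Sum>k. v (k + m)) / \<epsilon>\<^sup>2" for m
    proof -
      \<comment> \<open>The maximal inequality has a finite horizon; these events increase to
        \<open>Bad m\<close>, and continuity from below carries the bound over, as it does not
        depend on the horizon.\<close>
      define A where "A = (\<lambda>N. {\<omega> \<in> space M. \<exists>j\<in>{m..m + N}. \<epsilon> \<le> \<bar>S m j \<omega>\<bar>})"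
      have UN: "(\<Union>N. A N) = Bad m"
      proof
        show "Bad m \<subseteq> (\<Union>N. A N)"
        proof
          fix \<omega> assume "\<omega> \<in> Bad m"
          then obtain j where "\<omega> \<in> space M" "m \<le> j" "\<epsilon> \<le> \<bar>S m j \<omega>\<bar>" by (auto simp: Bad_def)
          then have "\<omega> \<in> A (j - m)" by (auto simp: A_def intro!: bexI[of _ j])
          then show "\<omega> \<in> (\<Union>N. A N)" by blast
        qed
      qed (auto simp: A_def Bad_def)
      have "(\<lambda>N. prob (A N)) \<longlonglongrightarrow> prob (\<Union>N. A N)"
        by (rule finite_Lim_measure_incseq) (auto simp: A_def incseq_def)
      moreover have "prob (A N) \<le> C\<^sup>2 * (\<Sum>k. v (k + m)) / \<epsilon>\<^sup>2" for N
      proof -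
        have "prob (A N) \<le> C\<^sup>2 * (\<Sum>k\<in>{m..<m + N}. v k) / \<epsilon>\<^sup>2"
          unfolding A_def S_def v_def using predictable a_le_1 le_add1 \<open>0 < \<epsilon>\<close>
          by (rule maximal_inequality)
        also have "(\<Sum>k\<in>{m..<m + N}. v k) = (\<Sum>k<N. v (k + m))"
          using sum.shift_bounds_nat_ivl[of v 0 m N] by (simp add: atLeast0LessThan add.commute)
        also have "\<dots> \<le> (\<Sum>k. v (k + m))"
          using L2 v by (intro sum_le_suminf) (auto simp: v_def[symmetric])
        finally show ?thesis by (simp add: divide_right_mono mult_left_mono)
      qed
      ultimately show ?thesis
        unfolding UN by (intro LIMSEQ_le_const2) auto
    qed
    have "(\<lambda>m. \<Sum>k. v (k + m)) \<longlonglongrightarrow> 0"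
      using suminf_exist_split2[of v] L2 by (simp add: v_def)
    then have lim: "(\<lambda>m. C\<^sup>2 * (\<Sum>k. v (k + m)) / \<epsilon>\<^sup>2) \<longlonglongrightarrow> 0"
      using tendsto_mult[OF tendsto_const[of "C\<^sup>2 / \<epsilon>\<^sup>2"]] by fastforce
    have "prob (\<Inter>m. Bad m) \<le> C\<^sup>2 * (\<Sum>k. v (k + m)) / \<epsilon>\<^sup>2" for m
      using finite_measure_mono[of "\<Inter>m. Bad m" "Bad m"] Bad_le[of m] Bad_sets by force
    then have "prob (\<Inter>m. Bad m) \<le> 0"
      using lim by (intro LIMSEQ_le_const) auto
    then have "prob (\<Inter>m. Bad m) = 0" by (simp add: measure_le_0_iff)
    moreover have "(\<Inter>m. Bad m) \<in> sets M" using Bad_sets by blast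
    ultimately have "AE \<omega> in M. \<omega> \<notin> (\<Inter>m. Bad m)"
      using prob_eq_0 by blast
    with AE_space show ?thesis
    proof eventually_elim
      case (elim \<omega>)
      then show ?case by (simp add: Bad_def) (meson not_le)
    qed
  qed
  \<comment> \<open>Restricting to countably many tolerances leaves a single null set.\<close>
  then have "AE \<omega> in M. \<forall>p. \<exists>m. \<forall>j\<ge>m. \<bar>S m j \<omega>\<bar> < 1 / real (Suc p)"
    by (subst AE_all_countable) simp
  then show ?thesis
  proof eventually_elim
    case (elim \<omega>)
    show ?case
      unfolding summable_Cauchy
    proof (intro allI impI)
      fix e :: real assume "0 < e"
      then obtain p where p: "1 / real (Suc p) < e / 2"
        using nat_approx_posE[of "e / 2"] by auto
      obtain m where m: "\<And>j. j \<ge> m \<Longrightarrow> \<bar>S m j \<omega>\<bar> < 1 / real (Suc p)"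
        using elim by blast
      \<comment> \<open>A block sum from \<open>i\<close> to \<open>j\<close> is the difference of
        two sums started at \<open>m\<close>, each below \<open>e / 2\<close>.\<close>
      have "\<bar>S i j \<omega>\<bar> < e" if "m \<le> i" for i j
      proof (cases "i \<le> j")
        case True
        then have "S m j \<omega> = S m i \<omega> + S i j \<omega>"
          unfolding S_def using that by (simp add: sum.atLeastLessThan_concat)
        then show ?thesis using m[of i] m[of j] True that p by linarith
      qed (use \<open>0 < e\<close> in \<open>simp add: S_def\<close>)
      then show "\<exists>N. \<forall>i\<ge>N. \<forall>j. norm (\<Sum>k\<in>{i..<j}. a k \<omega> * w k \<omega>) < e"
        unfolding S_def by auto
    qed
  qed
qed

text \<open>Stopping the coefficients when the sum of their squares exceeds a level reduces this
  to the square-integrable case.\<close>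

lemma AE_summable:
  fixes a :: "nat \<Rightarrow> 'a \<Rightarrow> real"
  assumes predictable: "\<And>k. a k \<in> borel_measurable (F k)"
    and a_le_1: "\<And>k \<omega>. \<omega> \<in> space M \<Longrightarrow> \<bar>a k \<omega>\<bar> \<le> 1"
    and sq: "AE \<omega> in M. summable (\<lambda>k. (a k \<omega>)\<^sup>2)"
  shows "AE \<omega> in M. summable (\<lambda>k. a k \<omega> * w k \<omega>)"
proof -
  \<comment> \<open>The sum includes the index \<open>k\<close> itself: \<open>a k\<close> is known
    at time \<open>k\<close>, so the coefficient that would push the sum above \<open>L\<close> is
    dropped and the level is never overshot.\<close>
  define b where "b = (\<lambda>L k \<omega>. if (\<Sum>i\<le>k. (a i \<omega>)\<^sup>2) \<le> real L then a k \<omega> else 0)"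
  have b_F: "b L k \<in> borel_measurable (F k)" for L k
  proof -
    have [measurable]: "a i \<in> borel_measurable (F k)" if "i \<in> {..k}" for i
      using measurable_filtration_mono[OF predictable] that by simp
    show ?thesis unfolding b_def by measurable
  qed
  have b_le_1: "\<bar>b L k \<omega>\<bar> \<le> 1" if "\<omega> \<in> space M" for L k \<omega>
    using a_le_1[OF that] by (simp add: b_def)
  have b_sq: "(\<Sum>k<N. (b L k \<omega>)\<^sup>2) \<le> real L" for L N \<omega>
  proof (induction N)
    case (Suc N)
    have "(\<Sum>k<N. (b L k \<omega>)\<^sup>2) \<le> (\<Sum>k<N. (a k \<omega>)\<^sup>2)"
      by (intro sum_mono) (auto simp: b_def)
    then show ?case
      using Suc by (auto simp: b_def lessThan_Suc_atMost[symmetric])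
  qed simp
  have "AE \<omega> in M. summable (\<lambda>k. b L k \<omega> * w k \<omega>)" for L
    using b_F b_le_1
  proof (rule AE_summable_L2)
    have int: "integrable M (\<lambda>\<omega>. (b L k \<omega>)\<^sup>2)" for k
      using b_F b_le_1 by (rule integrable_predictable_sq)
    show "summable (\<lambda>k. \<integral>\<omega>. (b L k \<omega>)\<^sup>2 \<partial>M)"
    proof (rule summableI_nonneg_bounded)
      fix N
      have "(\<Sum>k<N. \<integral>\<omega>. (b L k \<omega>)\<^sup>2 \<partial>M) = (\<integral>\<omega>. (\<Sum>k<N. (b L k \<omega>)\<^sup>2) \<partial>M)"
        using int by simp
      also have "\<dots> \<le> (\<integral>\<omega>. real L \<partial>M)"
        using int b_sq by (intro integral_mono) auto
      finally show "(\<Sum>k<N. \<integral>\<omega>. (b L k \<omega>)\<^sup>2 \<partial>M) \<le> real L" by (simp add: prob_space)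
    qed simp
  qed
  then have "AE \<omega> in M. \<forall>L. summable (\<lambda>k. b L k \<omega> * w k \<omega>)"
    by (subst AE_all_countable) simp
  with sq show ?thesis
  proof eventually_elim
    case (elim \<omega>)
    \<comment> \<open>The level depends on the path, which is why convergence was secured beforehand
      for all natural \<open>L\<close> on one event of full measure.\<close>
    obtain L :: nat where L: "(\<Sum>k. (a k \<omega>)\<^sup>2) \<le> real L"
      using real_arch_simple by blast
    have "(\<Sum>i\<le>k. (a i \<omega>)\<^sup>2) \<le> real L" for k
      using sum_le_suminf[OF elim(1), of "{..k}"] L by auto
    then have "b L k \<omega> = a k \<omega>" for k by (simp add: b_def)
    moreover from elim(2) have "summable (\<lambda>k. b L k \<omega> * w k \<omega>)" by blast
    ultimately show ?case by simp
  qed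
qed

end

section \<open>The Bellman equation\<close>

lemma abs_Min_range_diff_le:
  fixes f g :: "'g::finite \<Rightarrow> real"
  assumes "\<And>x. \<bar>f x - g x\<bar> \<le> B"
  shows "\<bar>Min (range f) - Min (range g)\<bar> \<le> B"
proof -
  have le: "Min (range f) \<le> Min (range g) + B" if "\<And>x. \<bar>f x - g x\<bar> \<le> B" for f g :: "'g \<Rightarrow> real"
  proof -
    have "Min (range g) \<in> range g" by (intro Min_in) auto
    then obtain x where x: "Min (range g) = g x" by (elim rangeE)
    have "Min (range f) \<le> f x" by simp
    with that[of x] x show ?thesis by linarith
  qed
  from le[of f g] le[of g f] assms show ?thesis by (force simp: abs_minus_commute abs_le_iff)
qed

lemma tendsto_Min_range:
  fixes f :: "nat \<Rightarrow> 'g::finite \<Rightarrow> real"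
  assumes "\<And>x. (\<lambda>k. f k x) \<longlonglongrightarrow> l x"
  shows "(\<lambda>k. Min (range (f k))) \<longlonglongrightarrow> Min (range l)"
proof -
  have "(\<lambda>k. \<Sum>x\<in>UNIV. \<bar>f k x - l x\<bar>) \<longlonglongrightarrow> (\<Sum>x\<in>UNIV. \<bar>l x - l x\<bar>)"
    by (intro tendsto_intros assms)
  then have lim: "(\<lambda>k. \<Sum>x\<in>UNIV. \<bar>f k x - l x\<bar>) \<longlonglongrightarrow> 0" by simp
  have "\<bar>Min (range (f k)) - Min (range l)\<bar> \<le> (\<Sum>x\<in>UNIV. \<bar>f k x - l x\<bar>)" for k
    by (intro abs_Min_range_diff_le member_le_sum) auto
  then have "(\<lambda>k. Min (range (f k)) - Min (range l)) \<longlonglongrightarrow> 0"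
    by (intro Lim_null_comparison[OF always_eventually lim]) simp
  then show ?thesis by (rule LIM_zero_cancel)
qed

definition bellman ::
  "real \<Rightarrow> 'd set \<Rightarrow> ('d \<Rightarrow> 'g \<Rightarrow> real) \<Rightarrow> ('d \<Rightarrow> 'g \<Rightarrow> 'd \<Rightarrow> real)
     \<Rightarrow> ('d \<Rightarrow> 'g::finite \<Rightarrow> real) \<Rightarrow> 'd \<Rightarrow> 'g \<Rightarrow> real" where
  "bellman \<beta> E cb p Q d \<gamma> = cb d \<gamma> + \<beta> * (\<Sum>d'\<in>E. p d \<gamma> d' * Min (range (Q d')))"

locale discounted_mdp =
  fixes \<beta> :: real and E :: "'d set" and cb :: "'d \<Rightarrow> 'g::finite \<Rightarrow> real"
    and p :: "'d \<Rightarrow> 'g \<Rightarrow> 'd \<Rightarrow> real"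
  assumes finite_E: "finite E" and \<beta>: "0 \<le> \<beta>" "\<beta> < 1"
    and p_nonneg: "\<And>d \<gamma> d'. d \<in> E \<Longrightarrow> 0 \<le> p d \<gamma> d'"
    and p_sum: "\<And>d \<gamma>. d \<in> E \<Longrightarrow> (\<Sum>d'\<in>E. p d \<gamma> d') = 1"
begin

lemma abs_p_average_le:
  assumes "d \<in> E" "\<And>d'. d' \<in> E \<Longrightarrow> \<bar>h d'\<bar> \<le> B"
  shows "\<bar>\<Sum>d'\<in>E. p d \<gamma> d' * h d'\<bar> \<le> B"
proof -
  have "\<bar>\<Sum>d'\<in>E. p d \<gamma> d' * h d'\<bar> \<le> (\<Sum>d'\<in>E. p d \<gamma> d' * B)"
    using assms p_nonneg by (intro order_trans[OF sum_abs] sum_mono) (auto simp: abs_mult mult_left_mono)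
  also have "\<dots> = B" using p_sum[OF assms(1)] by (simp flip: sum_distrib_right)
  finally show ?thesis .
qed

lemma bellman_contraction:
  assumes "d \<in> E" "\<And>d' \<gamma>. d' \<in> E \<Longrightarrow> \<bar>Q d' \<gamma> - Q' d' \<gamma>\<bar> \<le> B"
  shows "\<bar>bellman \<beta> E cb p Q d \<gamma> - bellman \<beta> E cb p Q' d \<gamma>\<bar> \<le> \<beta> * B"
proof -
  have "bellman \<beta> E cb p Q d \<gamma> - bellman \<beta> E cb p Q' d \<gamma>
    = \<beta> * (\<Sum>d'\<in>E. p d \<gamma> d' * (Min (range (Q d')) - Min (range (Q' d'))))"
    by (simp add: bellman_def algebra_simps sum_subtractf)
  also have "\<bar>\<dots>\<bar> \<le> \<beta> * B"
    using \<beta> assms by (auto simp: abs_mult intro!: mult_left_mono abs_p_average_le abs_Min_range_diff_le)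
  finally show ?thesis .
qed

text \<open>Existence is value iteration from 0, whose increments decay like powers of
  \<open>\<beta>\<close>; uniqueness iterates the contraction on the difference of two solutions.
  Fixing the value 0 outside \<open>E\<close> gives uniqueness as a total function, as the
  \<open>THE\<close> in \<open>Qstar\<close> requires.\<close>

lemma ex1_bellman_fixpoint:
  "\<exists>!Q. (\<forall>d\<in>E. \<forall>\<gamma>. Q d \<gamma> = bellman \<beta> E cb p Q d \<gamma>) \<and> (\<forall>d. d \<notin> E \<longrightarrow> (\<forall>\<gamma>. Q d \<gamma> = 0))"
proof (rule ex_ex1I)
  define U where "U = rec_nat (\<lambda>d \<gamma>. 0) (\<lambda>k Q d \<gamma>. if d \<in> E then bellman \<beta> E cb p Q d \<gamma> else 0)"
  have U0: "U 0 = (\<lambda>d \<gamma>. 0)" and U_Suc: "U (Suc k) = (\<lambda>d \<gamma>. if d \<in> E then bellman \<beta> E cb p (U k) d \<gamma> else 0)" for k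
    unfolding U_def by simp_all
  \<comment> \<open>The sum over all pairs is a crude substitute for the maximum: it dominates every
    single increment.\<close>
  define B where "B = (\<Sum>(d, \<gamma>)\<in>E \<times> UNIV. \<bar>U 1 d \<gamma>\<bar>)"
  have diff: "\<bar>U (Suc k) d \<gamma> - U k d \<gamma>\<bar> \<le> B * \<beta> ^ k" if "d \<in> E" for k d \<gamma>
    using that
  proof (induction k arbitrary: d \<gamma>)
    case 0
    have "(\<lambda>(d, \<gamma>). \<bar>U 1 d \<gamma>\<bar>) (d, \<gamma>) \<le> B"
      unfolding B_def using 0 finite_E by (intro member_le_sum) auto
    then show ?case by (simp add: U0)
  next
    case (Suc k)
    have "\<bar>bellman \<beta> E cb p (U (Suc k)) d \<gamma> - bellman \<beta> E cb p (U k) d \<gamma>\<bar> \<le> \<beta> * (B * \<beta> ^ k)"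
      using Suc by (intro bellman_contraction) auto
    then show ?case using U_Suc[of "Suc k"] U_Suc[of k] Suc.prems by (simp add: mult_ac)
  qed
  have conv: "convergent (\<lambda>k. U k d \<gamma>)" for d \<gamma>
  proof (cases "d \<in> E")
    case True
    have "summable (\<lambda>k. U (Suc k) d \<gamma> - U k d \<gamma>)"
    proof (rule summable_comparison_test')
      show "summable (\<lambda>k. B * \<beta> ^ k)"
        using \<beta> by (intro summable_mult summable_geometric) auto
      show "norm (U (Suc k) d \<gamma> - U k d \<gamma>) \<le> B * \<beta> ^ k" for k
        using diff[OF True] by simp
    qed
    then have "convergent (\<lambda>k. \<Sum>j<k. U (Suc j) d \<gamma> - U j d \<gamma>)"
      using summable_iff_convergent by blast
    then show ?thesis by (simp add: sum_lessThan_telescope[of "\<lambda>k. U k d \<gamma>"] U0)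
  next
    case False
    have "U k d \<gamma> = 0" for k using False by (cases k) (simp_all add: U0 U_Suc)
    then show ?thesis by (simp add: convergent_const)
  qed
  define L where "L = (\<lambda>d \<gamma>. lim (\<lambda>k. U k d \<gamma>))"
  have L: "(\<lambda>k. U k d \<gamma>) \<longlonglongrightarrow> L d \<gamma>" for d \<gamma>
    using conv by (simp add: L_def convergent_LIMSEQ_iff)
  show "\<exists>Q. (\<forall>d\<in>E. \<forall>\<gamma>. Q d \<gamma> = bellman \<beta> E cb p Q d \<gamma>) \<and> (\<forall>d. d \<notin> E \<longrightarrow> (\<forall>\<gamma>. Q d \<gamma> = 0))"
  proof (intro exI[of _ L] conjI ballI allI impI)
    fix d \<gamma> assume d: "d \<in> E"
    have "(\<lambda>k. U (Suc k) d \<gamma>) \<longlonglongrightarrow> bellman \<beta> E cb p L d \<gamma>"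
      unfolding U_Suc bellman_def using d by (simp, intro tendsto_intros tendsto_Min_range L)
    with LIMSEQ_Suc[OF L] show "L d \<gamma> = bellman \<beta> E cb p L d \<gamma>"
      by (rule LIMSEQ_unique)
  next
    fix d \<gamma> assume d: "d \<notin> E"
    have "(\<lambda>k. U (Suc k) d \<gamma>) \<longlonglongrightarrow> 0" using d by (simp add: U_Suc)
    with LIMSEQ_Suc[OF L] show "L d \<gamma> = 0" by (rule LIMSEQ_unique)
  qed
next
  fix Q Q'
  assume Q: "(\<forall>d\<in>E. \<forall>\<gamma>. Q d \<gamma> = bellman \<beta> E cb p Q d \<gamma>) \<and> (\<forall>d. d \<notin> E \<longrightarrow> (\<forall>\<gamma>. Q d \<gamma> = 0))"
    and Q': "(\<forall>d\<in>E. \<forall>\<gamma>. Q' d \<gamma> = bellman \<beta> E cb p Q' d \<gamma>) \<and> (\<forall>d. d \<notin> E \<longrightarrow> (\<forall>\<gamma>. Q' d \<gamma> = 0))"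
  define B where "B = (\<Sum>(d, \<gamma>)\<in>E \<times> UNIV. \<bar>Q d \<gamma> - Q' d \<gamma>\<bar>)"
  have diff: "\<bar>Q d \<gamma> - Q' d \<gamma>\<bar> \<le> B * \<beta> ^ k" if "d \<in> E" for k d \<gamma>
    using that
  proof (induction k arbitrary: d \<gamma>)
    case 0
    have "(\<lambda>(d, \<gamma>). \<bar>Q d \<gamma> - Q' d \<gamma>\<bar>) (d, \<gamma>) \<le> B"
      unfolding B_def using 0 finite_E by (intro member_le_sum) auto
    then show ?case by simp
  next
    case (Suc k)
    have "\<bar>bellman \<beta> E cb p Q d \<gamma> - bellman \<beta> E cb p Q' d \<gamma>\<bar> \<le> \<beta> * (B * \<beta> ^ k)"
      using Suc by (intro bellman_contraction) auto
    then show ?case using Q Q' Suc.prems by (simp add: mult_ac)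
  qed
  show "Q = Q'"
  proof (intro ext)
    fix d \<gamma>
    show "Q d \<gamma> = Q' d \<gamma>"
    proof (cases "d \<in> E")
      case True
      have "(\<lambda>k. B * \<beta> ^ k) \<longlonglongrightarrow> 0"
        using \<beta> by (intro tendsto_mult_right_zero LIMSEQ_power_zero) auto
      then have "\<bar>Q d \<gamma> - Q' d \<gamma>\<bar> \<le> 0"
        using diff[OF True] by (intro LIMSEQ_le_const) auto
      then show ?thesis by simp
    qed (use Q Q' in simp)
  qed
qed

end

section \<open>Deep states\<close>

lemma finite_emp_set: "finite (emp_set n :: ('s::finite \<Rightarrow> real) set)"
proof (rule finite_subset)
  show "emp_set n \<subseteq> Pi\<^sub>E UNIV (\<lambda>_::'s. (\<lambda>m. real m / real n) ` {..n})"
    by (auto simp: emp_set_def PiE_UNIV_domain)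
qed (simp add: finite_PiE)

lemma deep_in_emp_set:
  fixes xs :: "nat \<Rightarrow> 'x::finite"
  assumes "n \<ge> 1"
  shows "deep n xs \<in> emp_set n"
proof -
  have "card {i. i < n \<and> xs i = x} \<le> n" for x
    using card_mono[of "{..<n}" "{i. i < n \<and> xs i = x}"] by auto
  moreover have "(\<Sum>x\<in>UNIV. card {i. i < n \<and> xs i = x}) = n"
    using sum.group[of "{..<n}" "UNIV :: 'x set" xs "\<lambda>_. 1::nat"] by simp
  then have "(\<Sum>x\<in>UNIV. deep n xs x) = 1"
    using assms by (simp add: deep_def flip: sum_divide_distrib of_nat_sum)
  ultimately show ?thesis by (auto simp: emp_set_def deep_def)
qed

lemma deep_cong:
  assumes "\<And>i. i < n \<Longrightarrow> xs i = ys i"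
  shows "deep n xs = deep n ys"
proof -
  have "{i. i < n \<and> xs i = x} = {i. i < n \<and> ys i = x}" for x
    using assms by auto
  then show ?thesis by (simp add: deep_def)
qed

lemma deep_permute:
  assumes "\<pi> permutes {..<n}"
  shows "deep n (\<lambda>i. xs (\<pi> i)) = deep n xs"
proof
  fix x
  have "{i. i < n \<and> xs i = x} = \<pi> ` {i. i < n \<and> xs (\<pi> i) = x}"
  proof
    show "{i. i < n \<and> xs i = x} \<subseteq> \<pi> ` {i. i < n \<and> xs (\<pi> i) = x}"
    proof
      fix j assume "j \<in> {i. i < n \<and> xs i = x}"
      then show "j \<in> \<pi> ` {i. i < n \<and> xs (\<pi> i) = x}"
        using permutes_in_image[OF assms, of "inv \<pi> j"] permutes_inverses(1)[OF assms]
        by (intro image_eqI[of _ _ "inv \<pi> j"]) auto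
    qed
    show "\<pi> ` {i. i < n \<and> xs (\<pi> i) = x} \<subseteq> {i. i < n \<and> xs i = x}"
      using permutes_in_image[OF assms] by auto
  qed
  moreover have "inj_on \<pi> {i. i < n \<and> xs (\<pi> i) = x}"
    using permutes_inj_on[OF assms] .
  ultimately show "deep n (\<lambda>i. xs (\<pi> i)) x = deep n xs x"
    by (simp add: deep_def card_image)
qed

text \<open>Cancelling the common denominator, equal deep states mean equal multisets of agent
  states. Every claim that a quantity depends only on the deep state thereby becomes invariance
  under relabelling agents.\<close>

lemma deep_eq_imp_permutes:
  assumes "n \<ge> 1" "deep n xs = deep n ys"
  obtains \<pi> where "\<pi> permutes {..<n}" "\<And>i. i < n \<Longrightarrow> xs i = ys (\<pi> i)"
proof -
  have "card {i. i < n \<and> xs i = x} = card {i. i < n \<and> ys i = x}" for x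
    using fun_cong[OF assms(2), of x] assms(1) by (simp add: deep_def)
  then have "image_mset xs (mset_set {..<n}) = image_mset ys (mset_set {..<n})"
    by (intro multiset_eqI) (simp add: count_image_mset_eq_card_vimage)
  then obtain \<pi> where "\<pi> permutes {..<n}" "\<forall>i\<in>{..<n}. xs i = ys (\<pi> i)"
    using image_mset_eq_implies_permutes[OF finite_lessThan] by blast
  then show thesis using that by blast
qed

text \<open>Under a local law the action is a function of the state, so the joint empirical
  distribution sits on the graph of \<open>\<gamma>\<close>. The mean-field argument of dynamics and
  cost is thus determined by the deep state.\<close>

lemma empD_local_law: "empD n xs (\<lambda>i. \<gamma> (xs i)) = (\<lambda>(x, u). if \<gamma> x = u then deep n xs x else 0)"
proof -
  have "{i. i < n \<and> xs i = x \<and> \<gamma> (xs i) = u} = (if \<gamma> x = u then {i. i < n \<and> xs i = x} else {})" for x u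
    by auto
  then show ?thesis by (auto simp: empD_def deep_def)
qed

lemma empD_local_law_cong:
  "deep n xs = deep n ys \<Longrightarrow> empD n xs (\<lambda>i. \<gamma> (xs i)) = empD n ys (\<lambda>i. \<gamma> (ys i))"
  by (simp only: empD_local_law)

lemma deep_config_of: "deep n (config_of n (deep n xs)) = deep n xs"
  unfolding config_of_def by (rule someI[of _ xs]) (rule refl)

text \<open>The coordinates are i.i.d., and \<open>\<pi>\<close> maps indices outside
  \<open>{..<n}\<close> outside again, so the default value there is respected.\<close>

lemma noise_pmf_permute:
  assumes "\<pi> permutes {..<n}"
  shows "noise_pmf n PW = map_pmf (\<lambda>w. w \<circ> \<pi>) (noise_pmf n PW)"
  unfolding noise_pmf_def
  using permutes_imp_bij[OF assms] permutes_in_image[OF assms]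
  by (intro Pi_pmf_bij_betw) auto

text \<open>The permutation matching \<open>xs\<close> to \<open>ys\<close> is applied to the noise
  as well: its law is unchanged, and the resulting deep state does not see the labels.\<close>

lemma prob_deep_exchangeable:
  assumes "n \<ge> 1" "deep n xs = deep n ys"
  shows "measure_pmf.prob (noise_pmf n PW) {w. deep n (\<lambda>i. h (xs i) (w i)) = d'}
    = measure_pmf.prob (noise_pmf n PW) {w. deep n (\<lambda>i. h (ys i) (w i)) = d'}"
proof -
  obtain \<pi> where \<pi>: "\<pi> permutes {..<n}" "\<And>i. i < n \<Longrightarrow> xs i = ys (\<pi> i)"
    using deep_eq_imp_permutes[OF assms] by blast
  have "deep n (\<lambda>i. h (xs i) (w (\<pi> i))) = deep n (\<lambda>i. h (ys i) (w i))" for w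
  proof -
    have "deep n (\<lambda>i. h (xs i) (w (\<pi> i))) = deep n (\<lambda>i. h (ys (\<pi> i)) (w (\<pi> i)))"
      using \<pi>(2) by (intro deep_cong) simp
    also have "\<dots> = deep n (\<lambda>i. h (ys i) (w i))"
      using deep_permute[OF \<pi>(1), of "\<lambda>i. h (ys i) (w i)"] by simp
    finally show ?thesis .
  qed
  then show ?thesis
    by (subst noise_pmf_permute[OF \<pi>(1)]) (simp add: vimage_def)
qed

text \<open>The representative chosen by \<open>config_of\<close> may be replaced by the actual
  configuration. Exchangeability applies with the mean-field term held constant inside
  \<open>h\<close>, because both configurations produce the same one.\<close>

lemma trans_prob_deep:
  assumes "n \<ge> 1"
  shows "trans_prob n f PW (deep n xs) \<gamma> d' = measure_pmf.prob (noise_pmf n PW)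
    {w. deep n (\<lambda>i. f (xs i) (\<gamma> (xs i)) (empD n xs (\<lambda>i. \<gamma> (xs i))) (w i)) = d'}"
  using prob_deep_exchangeable[OF assms deep_config_of, of PW
      "\<lambda>x. f x (\<gamma> x) (empD n xs (\<lambda>i. \<gamma> (xs i)))" xs d']
  by (simp add: trans_prob_def Let_def empD_local_law_cong[OF deep_config_of])

lemma cbar_deep:
  assumes "n \<ge> 1"
  shows "cbar n c (deep n xs) \<gamma> = (\<Sum>i<n. c (xs i) (\<gamma> (xs i)) (empD n xs (\<lambda>i. \<gamma> (xs i)))) / real n"
proof -
  let ?ys = "config_of n (deep n xs)" and ?h = "\<lambda>x. c x (\<gamma> x) (empD n xs (\<lambda>i. \<gamma> (xs i)))"
  obtain \<pi> where \<pi>: "\<pi> permutes {..<n}" "\<And>i. i < n \<Longrightarrow> ?ys i = xs (\<pi> i)"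
    using deep_eq_imp_permutes[OF assms deep_config_of] by blast
  have "(\<Sum>i<n. ?h (?ys i)) = (\<Sum>i<n. ?h (xs (\<pi> i)))"
    using \<pi>(2) by simp
  also have "\<dots> = (\<Sum>i<n. ?h (xs i))"
    using sum.reindex_bij_betw[OF permutes_imp_bij[OF \<pi>(1)], of "\<lambda>i. ?h (xs i)"] by simp
  finally show ?thesis by (simp add: cbar_def Let_def empD_local_law_cong[OF deep_config_of])
qed

text \<open>The row is the law of the deep state of a random configuration. This includes
  \<open>d\<close> outside \<open>emp_set n\<close>, for which \<open>config_of\<close> still
  returns some configuration.\<close>

lemma trans_prob_sum:
  fixes f :: "'x::finite \<Rightarrow> 'u \<Rightarrow> ('x \<times> 'u \<Rightarrow> real) \<Rightarrow> 'w \<Rightarrow> 'x"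
  assumes "n \<ge> 1"
  shows "(\<Sum>d'\<in>emp_set n. trans_prob n f PW d \<gamma> d') = 1"
proof -
  define N where "N = (\<lambda>w. deep n (\<lambda>i. f (config_of n d i) (\<gamma> (config_of n d i))
    (empD n (config_of n d) (\<lambda>i. \<gamma> (config_of n d i))) (w i)))"
  have "(\<Sum>d'\<in>emp_set n. pmf (map_pmf N (noise_pmf n PW)) d') = 1"
    by (rule sum_pmf_eq_1) (auto simp: N_def finite_emp_set deep_in_emp_set[OF assms])
  then show ?thesis
    by (simp add: trans_prob_def N_def Let_def pmf_map vimage_def)
qed

lemma trans_prob_nonneg: "0 \<le> trans_prob n f PW d \<gamma> d'"
  by (simp add: trans_prob_def Let_def)

lemma discounted_mdp_trans_prob:
  fixes f :: "'x::finite \<Rightarrow> 'u::finite \<Rightarrow> ('x \<times> 'u \<Rightarrow> real) \<Rightarrow> 'w \<Rightarrow> 'x"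
  assumes "n \<ge> 1" "0 \<le> \<beta>" "\<beta> < 1"
  shows "discounted_mdp \<beta> (emp_set n) (trans_prob n f PW)"
  using assms trans_prob_sum[OF assms(1)] trans_prob_nonneg finite_emp_set
  by unfold_locales auto

lemma Qstar_bellman:
  fixes f :: "'x::finite \<Rightarrow> 'u::finite \<Rightarrow> ('x \<times> 'u \<Rightarrow> real) \<Rightarrow> 'w \<Rightarrow> 'x"
  assumes "n \<ge> 1" "0 \<le> \<beta>" "\<beta> < 1"
  shows "(\<forall>d\<in>emp_set n. \<forall>\<gamma>. Qstar n f PW c \<beta> d \<gamma>
        = bellman \<beta> (emp_set n) (cbar n c) (trans_prob n f PW) (Qstar n f PW c \<beta>) d \<gamma>)
      \<and> (\<forall>d. d \<notin> emp_set n \<longrightarrow> (\<forall>\<gamma>. Qstar n f PW c \<beta> d \<gamma> = 0))"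
proof -
  interpret discounted_mdp \<beta> "emp_set n" "cbar n c" "trans_prob n f PW"
    using assms by (rule discounted_mdp_trans_prob)
  from theI'[OF ex1_bellman_fixpoint] show ?thesis
    unfolding Qstar_def bellman_def .
qed

lemma expectation_deep:
  fixes P :: "(nat \<Rightarrow> 'x::finite) pmf"
  assumes "n \<ge> 1"
  shows "measure_pmf.expectation P (\<lambda>xs. V (deep n xs))
    = (\<Sum>d\<in>emp_set n. measure_pmf.prob P {xs. deep n xs = d} * V d)"
proof -
  have "measure_pmf.expectation P (\<lambda>xs. V (deep n xs)) = measure_pmf.expectation (map_pmf (deep n) P) V"
    by simp
  also have "\<dots> = (\<Sum>d\<in>emp_set n. V d * pmf (map_pmf (deep n) P) d)"
    by (rule integral_measure_pmf_real) (auto simp: finite_emp_set deep_in_emp_set[OF assms])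
  finally show ?thesis by (simp add: pmf_map vimage_def mult.commute)
qed

lemma stage_cost_deep:
  "n \<ge> 1 \<Longrightarrow> stage_cost n c g xs = cbar n c (deep n xs) (\<lambda>x. g x (deep n xs))"
  by (simp add: stage_cost_def cbar_deep Let_def)

lemma prob_step_cfg_deep:
  assumes "n \<ge> 1"
  shows "measure_pmf.prob (step_cfg n f PW g xs) {ys. deep n ys = d'}
    = trans_prob n f PW (deep n xs) (\<lambda>x. g x (deep n xs)) d'"
proof -
  \<comment> \<open>\<open>step_cfg\<close> fills the labels from \<open>n\<close> on with
    \<open>undefined\<close>, while \<open>deep\<close> counts only the labels below
    \<open>n\<close>.\<close>
  have restrict: "deep n (\<lambda>i. if i < n then F i else undefined) = deep n F" for F
    by (rule deep_cong) simp
  show ?thesis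
    by (simp add: restrict step_cfg_def Let_def trans_prob_deep[OF assms] vimage_def)
qed

section \<open>Discounted cost of a strategy\<close>

text \<open>Labels from \<open>n\<close> on are unconstrained, so a law on configurations may have
  infinite support; integrability rests on the finite range of \<open>deep\<close>.\<close>

lemma integrable_deep:
  fixes P :: "(nat \<Rightarrow> 'x::finite) pmf"
  assumes "n \<ge> 1"
  shows "integrable (measure_pmf P) (\<lambda>xs. H (deep n xs) :: real)"
proof -
  have "set_pmf (map_pmf (deep n) P) \<subseteq> emp_set n"
    using deep_in_emp_set[OF assms] by auto
  then have "integrable (measure_pmf (map_pmf (deep n) P)) H"
    using finite_emp_set finite_subset by (intro integrable_measure_pmf_finite) blast
  then show ?thesis by (simp add: integrable_map_pmf_eq)
qed

lemma abs_expectation_deep_le: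
  fixes P :: "(nat \<Rightarrow> 'x::finite) pmf" and H :: "('x \<Rightarrow> real) \<Rightarrow> real"
  assumes "n \<ge> 1"
  shows "\<bar>measure_pmf.expectation P (\<lambda>xs. H (deep n xs))\<bar> \<le> (\<Sum>d\<in>emp_set n. \<bar>H d\<bar>)"
  unfolding expectation_deep[OF assms, of P H]
  by (intro order_trans[OF sum_abs] sum_mono) (simp add: abs_mult mult_left_le_one_le)

text \<open>This is the Markov property: conditionally on a configuration, the law of the next deep
  state depends on that configuration only through its own deep state.\<close>

lemma expectation_deep_step:
  fixes f :: "'x::finite \<Rightarrow> 'u \<Rightarrow> ('x \<times> 'u \<Rightarrow> real) \<Rightarrow> 'w \<Rightarrow> 'x"
  assumes "n \<ge> 1"
  shows "measure_pmf.expectation (bind_pmf P (step_cfg n f PW g)) (\<lambda>xs. V (deep n xs))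
    = measure_pmf.expectation P (\<lambda>xs. \<Sum>d'\<in>emp_set n.
        trans_prob n f PW (deep n xs) (\<lambda>x. g x (deep n xs)) d' * V d')"
proof -
  have "measure_pmf.prob (bind_pmf P (step_cfg n f PW g)) {ys. deep n ys = d'}
      = measure_pmf.expectation P (\<lambda>xs. trans_prob n f PW (deep n xs) (\<lambda>x. g x (deep n xs)) d')" for d'
  proof -
    have "measure_pmf.prob (bind_pmf P (step_cfg n f PW g)) {ys. deep n ys = d'}
        = pmf (bind_pmf P (\<lambda>xs. map_pmf (deep n) (step_cfg n f PW g xs))) d'"
      by (simp add: pmf_map vimage_def flip: map_bind_pmf)
    then show ?thesis
      by (simp add: pmf_bind pmf_map vimage_def prob_step_cfg_deep[OF assms])
  qed
  moreover have "integrable (measure_pmf P)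
      (\<lambda>xs. trans_prob n f PW (deep n xs) (\<lambda>x. g x (deep n xs)) d' * V d')" for d'
    using integrable_deep[OF assms, of P "\<lambda>d. trans_prob n f PW d (\<lambda>x. g x d) d' * V d'"] .
  ultimately show ?thesis
    unfolding expectation_deep[OF assms, of _ V] by simp
qed

text \<open>Performance difference formula: the excess cost of \<open>g\<close> is the discounted sum of the
  expected suboptimality gaps of the local laws that it applies.\<close>

lemma Jcost_suboptimality:
  fixes f :: "'x::finite \<Rightarrow> 'u::finite \<Rightarrow> ('x \<times> 'u \<Rightarrow> real) \<Rightarrow> 'w \<Rightarrow> 'x"
    and g :: "'x \<Rightarrow> ('x \<Rightarrow> real) \<Rightarrow> 'u" and PW :: "'w pmf"
    and c :: "'x \<Rightarrow> 'u \<Rightarrow> ('x \<times> 'u \<Rightarrow> real) \<Rightarrow> real"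
    and mu0 :: "(nat \<Rightarrow> 'x) pmf"
  assumes n: "n \<ge> 1" and \<beta>: "0 \<le> \<beta>" "\<beta> < 1"
  defines "Q \<equiv> Qstar n f PW c \<beta>"
  defines "V \<equiv> \<lambda>d. Min (range (Q d))"
  defines "\<delta> \<equiv> \<lambda>t. measure_pmf.expectation (cfg_dist n f PW mu0 g t)
    (\<lambda>xs. Q (deep n xs) (\<lambda>x. g x (deep n xs)) - V (deep n xs))"
  shows "summable (\<lambda>t. \<beta> ^ t * \<delta> t)"
    and "Jcost n f PW c \<beta> mu0 g
      = (1 - \<beta>) * (measure_pmf.expectation mu0 (\<lambda>xs. V (deep n xs)) + (\<Sum>t. \<beta> ^ t * \<delta> t))"
proof -
  define e where "e = (\<lambda>t. measure_pmf.expectation (cfg_dist n f PW mu0 g t) (\<lambda>xs. V (deep n xs)))"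
  define s where "s = (\<lambda>t. measure_pmf.expectation (cfg_dist n f PW mu0 g t) (stage_cost n c g))"
  have int: "integrable (measure_pmf P) (\<lambda>xs. H (deep n xs) :: real)" for P :: "(nat \<Rightarrow> 'x) pmf" and H
    using n by (rule integrable_deep)
  \<comment> \<open>The Bellman equation splits \<open>Q\<close> into stage cost and discounted next
    value, and the Markov step turns the expectation of the latter into
    \<open>e (Suc t)\<close>.\<close>
  have gap: "\<delta> t = s t + \<beta> * e (Suc t) - e t" for t
  proof -
    let ?P = "cfg_dist n f PW mu0 g t"
    define W where "W = (\<lambda>d. \<Sum>d'\<in>emp_set n. trans_prob n f PW d (\<lambda>x. g x d) d' * V d')"
    define C where "C = (\<lambda>d. cbar n c d (\<lambda>x. g x d))"
    have "Q (deep n xs) (\<lambda>x. g x (deep n xs)) = C (deep n xs) + \<beta> * W (deep n xs)" for xs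
      using Qstar_bellman[OF n \<beta>, of f PW c] deep_in_emp_set[OF n, of xs]
      unfolding Q_def V_def W_def C_def bellman_def by blast
    then have "\<delta> t = measure_pmf.expectation ?P (\<lambda>xs. C (deep n xs) + \<beta> * W (deep n xs) - V (deep n xs))"
      by (simp add: \<delta>_def)
    also have "\<dots> = measure_pmf.expectation ?P (\<lambda>xs. C (deep n xs))
        + \<beta> * measure_pmf.expectation ?P (\<lambda>xs. W (deep n xs)) - e t"
      using int[of ?P C] int[of ?P W] int[of ?P V] by (simp add: e_def)
    also have "measure_pmf.expectation ?P (\<lambda>xs. W (deep n xs)) = e (Suc t)"
      by (simp add: e_def W_def expectation_deep_step[OF n, where V=V])
    also have "measure_pmf.expectation ?P (\<lambda>xs. C (deep n xs)) = s t"
      unfolding s_def C_def by (intro Bochner_Integration.integral_cong) (simp_all add: stage_cost_deep[OF n])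
    finally show ?thesis .
  qed
  have geom: "summable (\<lambda>t. \<beta> ^ t * h t)" if "\<And>t. \<bar>h t\<bar> \<le> K" for h :: "nat \<Rightarrow> real" and K
  proof (rule summable_comparison_test')
    show "summable (\<lambda>t. K * \<beta> ^ t)"
      using \<beta> by (intro summable_mult summable_geometric) auto
    show "norm (\<beta> ^ t * h t) \<le> K * \<beta> ^ t" for t
      using mult_right_mono[OF that, of "\<beta> ^ t" t] \<beta> by (simp add: abs_mult mult.commute)
  qed
  show \<delta>: "summable (\<lambda>t. \<beta> ^ t * \<delta> t)"
    unfolding \<delta>_def using abs_expectation_deep_le[OF n, of _ "\<lambda>d. Q d (\<lambda>x. g x d) - V d"] by (rule geom)
  have "(\<lambda>t. \<beta> ^ t * e t) \<longlonglongrightarrow> 0"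
    unfolding e_def using abs_expectation_deep_le[OF n, of _ V] by (intro summable_LIMSEQ_zero geom)
  \<comment> \<open>The discounted values telescope to the initial one; they vanish in the limit
    because functions on finitely many deep states are bounded.\<close>
  from telescope_sums'[OF this] have tel: "(\<lambda>t. \<beta> ^ t * e t - \<beta> ^ Suc t * e (Suc t)) sums e 0"
    by simp
  have "\<beta> ^ t * s t = (\<beta> ^ t * e t - \<beta> ^ Suc t * e (Suc t)) + \<beta> ^ t * \<delta> t" for t
    by (simp add: gap algebra_simps)
  then have "(\<lambda>t. \<beta> ^ t * s t) sums (e 0 + (\<Sum>t. \<beta> ^ t * \<delta> t))"
    using sums_add[OF tel summable_sums[OF \<delta>]] by presburger
  then have "(\<Sum>t. \<beta> ^ t * s t) = e 0 + (\<Sum>t. \<beta> ^ t * \<delta> t)" by (rule sums_unique[symmetric])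
  then show "Jcost n f PW c \<beta> mu0 g
      = (1 - \<beta>) * (measure_pmf.expectation mu0 (\<lambda>xs. V (deep n xs)) + (\<Sum>t. \<beta> ^ t * \<delta> t))"
    by (simp add: Jcost_def s_def e_def)
qed

text \<open>Only the gaps in the performance difference formula depend on \<open>g\<close>, and each
  is nonnegative, being a value of \<open>Qstar\<close> minus its minimum over local laws.\<close>

lemma Jcost_ge:
  fixes f :: "'x::finite \<Rightarrow> 'u::finite \<Rightarrow> ('x \<times> 'u \<Rightarrow> real) \<Rightarrow> 'w \<Rightarrow> 'x"
  assumes n: "n \<ge> 1" and \<beta>: "0 \<le> \<beta>" "\<beta> < 1"
  shows "(1 - \<beta>) * measure_pmf.expectation mu0 (\<lambda>xs. Min (range (Qstar n f PW c \<beta> (deep n xs))))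
    \<le> Jcost n f PW c \<beta> mu0 g"
  unfolding Jcost_suboptimality(2)[OF assms]
  using \<beta> Jcost_suboptimality(1)[OF assms, where f=f and PW=PW and c=c and ?mu0.0=mu0 and g=g]
  by (auto intro!: mult_left_mono suminf_nonneg mult_nonneg_nonneg Bochner_Integration.integral_nonneg)

lemma Jcost_greedy:
  fixes f :: "'x::finite \<Rightarrow> 'u::finite \<Rightarrow> ('x \<times> 'u \<Rightarrow> real) \<Rightarrow> 'w \<Rightarrow> 'x"
  assumes n: "n \<ge> 1" and \<beta>: "0 \<le> \<beta>" "\<beta> < 1"
    and greedy: "\<And>d \<gamma>. d \<in> emp_set n \<Longrightarrow> Qstar n f PW c \<beta> d (\<lambda>x. g x d) \<le> Qstar n f PW c \<beta> d \<gamma>"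
  shows "Jcost n f PW c \<beta> mu0 g
    = (1 - \<beta>) * measure_pmf.expectation mu0 (\<lambda>xs. Min (range (Qstar n f PW c \<beta> (deep n xs))))"
proof -
  have "Qstar n f PW c \<beta> (deep n xs) (\<lambda>x. g x (deep n xs)) = Min (range (Qstar n f PW c \<beta> (deep n xs)))" for xs
    using greedy[OF deep_in_emp_set[OF n]] by (intro Min_eqI[symmetric]) auto
  then show ?thesis
    by (simp add: Jcost_suboptimality(2)[OF n \<beta>])
qed

text \<open>The lower bound common to all strategies is attained by \<open>g\<close>, so the infimum
  is a minimum.\<close>

lemma Jcost_greedy_eq_Jopt:
  fixes f :: "'x::finite \<Rightarrow> 'u::finite \<Rightarrow> ('x \<times> 'u \<Rightarrow> real) \<Rightarrow> 'w \<Rightarrow> 'x"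
  assumes n: "n \<ge> 1" and \<beta>: "0 \<le> \<beta>" "\<beta> < 1"
    and greedy: "\<And>d \<gamma>. d \<in> emp_set n \<Longrightarrow> Qstar n f PW c \<beta> d (\<lambda>x. g x d) \<le> Qstar n f PW c \<beta> d \<gamma>"
  shows "Jcost n f PW c \<beta> mu0 g = Jopt n f PW c \<beta> mu0"
  unfolding Jopt_def
proof (rule cInf_eq_minimum[symmetric])
  show "Jcost n f PW c \<beta> mu0 g \<le> J" if "J \<in> range (Jcost n f PW c \<beta> mu0)" for J
    using that Jcost_ge[OF n \<beta>] Jcost_greedy[OF assms] by auto
qed simp

section \<open>Q-learning\<close>

lemma trans_prob_le_1: "trans_prob n f PW d \<gamma> d' \<le> 1"
  by (simp add: trans_prob_def Let_def)

lemma abs_of_bool_minus_trans_prob_le: "\<bar>of_bool b - trans_prob n f PW d \<gamma> d'\<bar> \<le> 1"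
  using trans_prob_nonneg[of n f PW d \<gamma> d'] trans_prob_le_1[of n f PW d \<gamma> d'] by auto

text \<open>Rows that are never visited keep their initial value 0, which makes a sampled next state
  outside \<open>S\<close> harmless.\<close>

lemma qlearn_outside:
  assumes "\<And>j. ds j \<in> S" "d \<notin> S"
  shows "qlearn \<beta> cb ds gs ds' et k d \<gamma> = 0"
  using assms by (induction k) auto

text \<open>\<open>K / (1 - \<beta>)\<close> is the fixed point of the map taking \<open>B\<close>
  to \<open>K + \<beta> * B\<close>, and each update is a convex combination of the old value and a
  target obeying that bound.\<close>

lemma qlearn_bounded:
  assumes \<beta>: "0 \<le> \<beta>" "\<beta> < 1" and ds: "\<And>j. ds j \<in> S"
    and et: "\<And>j d \<gamma>. 0 \<le> et j d \<gamma> \<and> et j d \<gamma> \<le> 1"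
    and cb: "\<And>d \<gamma>. d \<in> S \<Longrightarrow> \<bar>cb d \<gamma>\<bar> \<le> K"
  shows "\<bar>qlearn \<beta> cb ds gs ds' et k d \<gamma>\<bar> \<le> K / (1 - \<beta>)"
proof (induction k arbitrary: d \<gamma>)
  case 0
  \<comment> \<open>A visited state witnesses that \<open>S\<close> is nonempty.\<close>
  have "0 \<le> K" using order_trans[OF abs_ge_zero cb[OF ds]] .
  then show ?case using \<beta> by simp
next
  case (Suc k)
  let ?Q = "qlearn \<beta> cb ds gs ds' et k"
  define B where "B = K / (1 - \<beta>)"
  have IH: "\<bar>?Q d \<gamma>\<bar> \<le> B" for d \<gamma> using Suc by (simp add: B_def)
  show ?case
  proof (cases "d = ds k \<and> \<gamma> = gs k")
    case True
    have "\<bar>Min (range (?Q (ds' k)))\<bar> \<le> B"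
      using abs_Min_range_diff_le[of "?Q (ds' k)" "\<lambda>_. 0" B] IH by simp
    then have "\<bar>\<beta> * Min (range (?Q (ds' k)))\<bar> \<le> \<beta> * B"
      using \<beta> by (simp only: abs_mult abs_of_nonneg mult_left_mono)
    moreover have "\<bar>cb d \<gamma>\<bar> \<le> K" using cb ds True by blast
    ultimately have "\<bar>cb d \<gamma> + \<beta> * Min (range (?Q (ds' k)))\<bar> \<le> K + \<beta> * B" by linarith
    also have "\<dots> = B" using \<beta> by (simp add: B_def field_simps)
    finally have target: "\<bar>cb d \<gamma> + \<beta> * Min (range (?Q (ds' k)))\<bar> \<le> B" .
    have "\<bar>(1 - et k d \<gamma>) * ?Q d \<gamma> + et k d \<gamma> * (cb d \<gamma> + \<beta> * Min (range (?Q (ds' k))))\<bar>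
        \<le> (1 - et k d \<gamma>) * B + et k d \<gamma> * B"
      using et[of k d \<gamma>] IH[of d \<gamma>] target
      by (intro order_trans[OF abs_triangle_ineq] add_mono) (simp_all add: abs_mult mult_left_mono)
    then show ?thesis using True by (simp add: B_def algebra_simps)
  qed (use Suc in auto)
qed

section \<open>The Q-iteration as a process adapted to its history\<close>

locale deep_qlearning = prob_space M for M :: "'a measure" +
  fixes n :: nat and \<beta> :: real
    and f :: "'x::finite \<Rightarrow> 'u::finite \<Rightarrow> ('x \<times> 'u \<Rightarrow> real) \<Rightarrow> 'w::finite \<Rightarrow> 'x"
    and PW :: "'w pmf"
    and c :: "'x \<Rightarrow> 'u \<Rightarrow> ('x \<times> 'u \<Rightarrow> real) \<Rightarrow> real"
    and D :: "nat \<Rightarrow> 'a \<Rightarrow> ('x \<Rightarrow> real)"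
    and \<Gamma> :: "nat \<Rightarrow> 'a \<Rightarrow> ('x \<Rightarrow> 'u)"
    and D' :: "nat \<Rightarrow> 'a \<Rightarrow> ('x \<Rightarrow> real)"
    and \<eta> :: "nat \<Rightarrow> 'a \<Rightarrow> ('x \<Rightarrow> real) \<Rightarrow> ('x \<Rightarrow> 'u) \<Rightarrow> real"
  assumes n_pos: "n \<ge> 1"
    and \<beta>_pos: "0 < \<beta>" and \<beta>_less_1: "\<beta> < 1"
    and D_meas: "\<And>k. D k \<in> measurable M (count_space UNIV)"
    and \<Gamma>_meas: "\<And>k. \<Gamma> k \<in> measurable M (count_space UNIV)"
    and D'_meas: "\<And>k. D' k \<in> measurable M (count_space UNIV)"
    and \<eta>_meas: "\<And>k d \<gamma>. (\<lambda>\<omega>. \<eta> k \<omega> d \<gamma>) \<in> borel_measurable M"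
    and D_range: "\<And>k \<omega>. \<omega> \<in> space M \<Longrightarrow> D k \<omega> \<in> emp_set n"
    and \<eta>_range: "\<And>k \<omega> d \<gamma>. \<omega> \<in> space M \<Longrightarrow> 0 \<le> \<eta> k \<omega> d \<gamma> \<and> \<eta> k \<omega> d \<gamma> \<le> 1"
    and next_law: "\<And>k d'' A. A \<in> hist_sets M D \<Gamma> D' \<eta> k \<Longrightarrow>
        measure M (A \<inter> {\<omega> \<in> space M. D' k \<omega> = d''})
          = (\<integral>\<omega>. indicator A \<omega> * trans_prob n f PW (D k \<omega>) (\<Gamma> k \<omega>) d'' \<partial>M)"
    and rate_div: "AE \<omega> in M. \<forall>d\<in>emp_set n. \<forall>\<gamma>.
        \<not> summable (\<lambda>k. if D k \<omega> = d \<and> \<Gamma> k \<omega> = \<gamma> then \<eta> k \<omega> d \<gamma> else 0)"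
    and rate_sq: "AE \<omega> in M. \<forall>d\<in>emp_set n. \<forall>\<gamma>.
        summable (\<lambda>k. if D k \<omega> = d \<and> \<Gamma> k \<omega> = \<gamma> then (\<eta> k \<omega> d \<gamma>)\<^sup>2 else 0)"
begin

abbreviation "E \<equiv> emp_set n :: ('x \<Rightarrow> real) set"
abbreviation "p \<equiv> trans_prob n f PW"
abbreviation "Qs \<equiv> Qstar n f PW c \<beta>"
abbreviation "H \<equiv> hist_sets M D \<Gamma> D' \<eta>"

definition Q :: "nat \<Rightarrow> 'a \<Rightarrow> ('x \<Rightarrow> real) \<Rightarrow> ('x \<Rightarrow> 'u) \<Rightarrow> real" where
  "Q k \<omega> = qlearn \<beta> (cbar n c) (\<lambda>j. D j \<omega>) (\<lambda>j. \<Gamma> j \<omega>) (\<lambda>j. D' j \<omega>) (\<lambda>j. \<eta> j \<omega>) k"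

definition V :: "nat \<Rightarrow> 'a \<Rightarrow> ('x \<Rightarrow> real) \<Rightarrow> real" where
  "V k \<omega> d = Min (range (Q k \<omega> d))"

text \<open>The history at \<open>k\<close> contains the current pair and the learning rates but
  only the next states drawn before \<open>k\<close>: the rates are predictable and
  \<open>D' k\<close> is the fresh randomness.\<close>

definition F :: "nat \<Rightarrow> 'a measure" where
  "F k = sigma (space M) (H k)"

text \<open>A pair that is not visited performs a step of size 0, which turns the asynchronous
  update into one recursion valid for every pair.\<close>

definition rate :: "nat \<Rightarrow> 'a \<Rightarrow> ('x \<Rightarrow> real) \<Rightarrow> ('x \<Rightarrow> 'u) \<Rightarrow> real" where
  "rate k \<omega> d \<gamma> = (if D k \<omega> = d \<and> \<Gamma> k \<omega> = \<gamma> then \<eta> k \<omega> d \<gamma> else 0)"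

text \<open>This is the centred next-state value at the visited pair. Expanding it over the possible
  next states reduces measurability and orthogonality to one centred indicator at a time.\<close>

definition noise :: "nat \<Rightarrow> 'a \<Rightarrow> real" where
  "noise k \<omega> = \<beta> * (\<Sum>d'\<in>E. V k \<omega> d' * (of_bool (D' k \<omega> = d') - p (D k \<omega>) (\<Gamma> k \<omega>) d'))"

sublocale mdp: discounted_mdp \<beta> E "cbar n c" p
  using n_pos \<beta>_pos \<beta>_less_1 by (intro discounted_mdp_trans_prob) auto

lemma finite_E [simp]: "finite E"
  by (rule finite_emp_set)

lemma hist_sets_subset: "H k \<subseteq> sets M"
  unfolding hist_sets_def
  using D_meas \<Gamma>_meas D'_meas \<eta>_meas
  by (intro sets.sigma_sets_subset) (auto intro: measurable_sets)

lemma space_F [simp]: "space (F k) = space M"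
  by (simp add: F_def space_measure_of_conv)

lemma sets_F [simp]: "sets (F k) = H k"
proof -
  have "H k \<subseteq> Pow (space M)"
    using hist_sets_subset sets.space_closed by blast
  moreover have "sigma_sets (space M) (H k) = H k"
    unfolding hist_sets_def by (rule sigma_sets_sigma_sets_eq)
      (use D_meas in auto)
  ultimately show ?thesis by (simp add: F_def)
qed

lemma hist_sets_Suc: "H k \<subseteq> H (Suc k)"
  unfolding hist_sets_def by (intro sigma_sets_mono' Un_mono UN_mono) auto

lemma subalgebra_F: "subalgebra M (F k)"
  using hist_sets_subset by (simp add: subalgebra_def)

lemma measurable_F_Suc: "X \<in> measurable (F k) N \<Longrightarrow> X \<in> measurable (F (Suc k)) N"
  using hist_sets_Suc[of k] by (intro measurable_from_subalg[of "F (Suc k)" "F k"]) (auto simp: subalgebra_def)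

lemma D_F [measurable]: "D k \<in> measurable (F k) (count_space UNIV)"
  by (rule measurableI) (auto simp: hist_sets_def intro!: sigma_sets.Basic)

lemma \<Gamma>_F [measurable]: "\<Gamma> k \<in> measurable (F k) (count_space UNIV)"
  by (rule measurableI) (auto simp: hist_sets_def intro!: sigma_sets.Basic)

lemma \<eta>_F [measurable]: "(\<lambda>\<omega>. \<eta> k \<omega> d \<gamma>) \<in> borel_measurable (F k)"
  by (rule measurableI) (auto simp: hist_sets_def intro!: sigma_sets.Basic)

lemma D'_F: "D' k \<in> measurable (F (Suc k)) (count_space UNIV)"
  by (rule measurableI) (auto simp: hist_sets_def intro!: sigma_sets.Basic)

lemma rate_F: "(\<lambda>\<omega>. rate k \<omega> d \<gamma>) \<in> borel_measurable (F k)"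
  unfolding rate_def by measurable

lemma p_F: "(\<lambda>\<omega>. p (D k \<omega>) (\<Gamma> k \<omega>) d') \<in> borel_measurable (F k)"
proof -
  \<comment> \<open>Deep states range over an uncountable type, so measurability of a function of
    the pair is obtained by splitting over the finitely many values that the pair takes.\<close>
  have "p (D k \<omega>) (\<Gamma> k \<omega>) d' = (\<Sum>d\<in>E. \<Sum>\<gamma>\<in>UNIV. if D k \<omega> = d \<and> \<Gamma> k \<omega> = \<gamma> then p d \<gamma> d' else 0)"
    if "\<omega> \<in> space M" for \<omega>
  proof -
    have "(\<Sum>d\<in>E. \<Sum>\<gamma>\<in>UNIV. if D k \<omega> = d \<and> \<Gamma> k \<omega> = \<gamma> then p d \<gamma> d' else 0)
        = (\<Sum>d\<in>E. if D k \<omega> = d then p d (\<Gamma> k \<omega>) d' else 0)"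
      by (intro sum.cong) auto
    then show ?thesis using D_range[OF that] by simp
  qed
  moreover have "(\<lambda>\<omega>. \<Sum>d\<in>E. \<Sum>\<gamma>\<in>UNIV. if D k \<omega> = d \<and> \<Gamma> k \<omega> = \<gamma> then p d \<gamma> d' else 0)
      \<in> borel_measurable (F k)"
    by measurable
  ultimately show ?thesis by (subst measurable_cong) auto
qed

lemma Q_outside: "\<omega> \<in> space M \<Longrightarrow> d \<notin> E \<Longrightarrow> Q k \<omega> d \<gamma> = 0"
  unfolding Q_def using D_range by (intro qlearn_outside) auto

definition Q_bound :: real where
  "Q_bound = (\<Sum>(d, \<gamma>)\<in>E \<times> UNIV. \<bar>cbar n c d \<gamma>\<bar>) / (1 - \<beta>)"

lemma Q_bounded: "\<omega> \<in> space M \<Longrightarrow> \<bar>Q k \<omega> d \<gamma>\<bar> \<le> Q_bound"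
  unfolding Q_def Q_bound_def
proof (rule qlearn_bounded)
  show "\<bar>cbar n c d \<gamma>\<bar> \<le> (\<Sum>(d, \<gamma>)\<in>E \<times> UNIV. \<bar>cbar n c d \<gamma>\<bar>)" if "d \<in> E" for d \<gamma>
    using member_le_sum[of "(d, \<gamma>)" "E \<times> UNIV" "\<lambda>(d, \<gamma>). \<bar>cbar n c d \<gamma>\<bar>"] that
    by auto
qed (use D_range \<eta>_range \<beta>_pos \<beta>_less_1 in auto)

lemma V_bounded: "\<omega> \<in> space M \<Longrightarrow> \<bar>V k \<omega> d\<bar> \<le> Q_bound"
  using abs_Min_range_diff_le[of "Q k \<omega> d" "\<lambda>_. 0"] Q_bounded by (simp add: V_def)

text \<open>\<open>D' k\<close> is not assumed to stay in \<open>E\<close> on every path; off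
  \<open>E\<close> both sides are 0 because such rows of \<open>Q\<close> are never updated.\<close>

lemma V_D': "\<omega> \<in> space M \<Longrightarrow> V k \<omega> (D' k \<omega>) = (\<Sum>d'\<in>E. V k \<omega> d' * of_bool (D' k \<omega> = d'))"
proof -
  assume \<omega>: "\<omega> \<in> space M"
  have "(\<Sum>d'\<in>E. V k \<omega> d' * of_bool (D' k \<omega> = d')) = (\<Sum>d'\<in>E. if D' k \<omega> = d' then V k \<omega> d' else 0)"
    by (intro sum.cong) auto
  moreover have "V k \<omega> (D' k \<omega>) = 0" if "D' k \<omega> \<notin> E"
    using Q_outside[OF \<omega> that] by (simp add: V_def)
  ultimately show ?thesis by auto
qed

lemma Q_Suc: "Q (Suc k) \<omega> d \<gamma> = (1 - rate k \<omega> d \<gamma>) * Q k \<omega> d \<gamma>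
    + rate k \<omega> d \<gamma> * (cbar n c d \<gamma> + \<beta> * V k \<omega> (D' k \<omega>))"
  by (auto simp: Q_def V_def rate_def)

lemma V_F_if_Q_F:
  "(\<And>\<gamma>. (\<lambda>\<omega>. Q k \<omega> d \<gamma>) \<in> borel_measurable N) \<Longrightarrow> (\<lambda>\<omega>. V k \<omega> d) \<in> borel_measurable N"
  unfolding V_def by (intro borel_measurable_Min) auto

text \<open>The only delicate term reads a row of \<open>Q\<close> at the random index
  \<open>D' k\<close>; written as a finite sum of indicators it becomes a measurable expression at
  time \<open>Suc k\<close>.\<close>

lemma Q_F: "(\<lambda>\<omega>. Q k \<omega> d \<gamma>) \<in> borel_measurable (F k)"
proof (induction k arbitrary: d \<gamma>)
  case 0
  show ?case by (simp add: Q_def)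
next
  case (Suc k)
  note [measurable] = measurable_F_Suc[OF Suc] measurable_F_Suc[OF V_F_if_Q_F[OF Suc]]
    measurable_F_Suc[OF rate_F] D'_F
  have "(\<lambda>\<omega>. (1 - rate k \<omega> d \<gamma>) * Q k \<omega> d \<gamma>
      + rate k \<omega> d \<gamma> * (cbar n c d \<gamma> + \<beta> * (\<Sum>d'\<in>E. V k \<omega> d' * of_bool (D' k \<omega> = d'))))
      \<in> borel_measurable (F (Suc k))"
    by measurable
  then show ?case
    by (subst measurable_cong) (auto simp: Q_Suc V_D')
qed

lemma V_F: "(\<lambda>\<omega>. V k \<omega> d) \<in> borel_measurable (F k)"
  using Q_F by (rule V_F_if_Q_F)

text \<open>On history events \<open>next_law\<close> says that the centred indicator has
  conditional expectation 0 given \<open>F k\<close>; a bounded function of the history can be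
  pulled out of that conditional expectation.\<close>

lemma next_state_orthogonal:
  assumes Y: "Y \<in> borel_measurable (F k)" and bdd: "\<And>\<omega>. \<omega> \<in> space M \<Longrightarrow> \<bar>Y \<omega>\<bar> \<le> B"
  shows "(\<integral>\<omega>. Y \<omega> * (of_bool (D' k \<omega> = d') - p (D k \<omega>) (\<Gamma> k \<omega>) d') \<partial>M) = 0"
proof -
  interpret sub: finite_measure_subalgebra M "F k"
    by unfold_locales (rule subalgebra_F)
  define h where "h = (\<lambda>\<omega>. of_bool (D' k \<omega> = d') - p (D k \<omega>) (\<Gamma> k \<omega>) d')"
  have [measurable]: "D' k \<in> measurable M (count_space UNIV)" by (rule D'_meas)
  have [measurable]: "(\<lambda>\<omega>. p (D k \<omega>) (\<Gamma> k \<omega>) d') \<in> borel_measurable M"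
    using subalgebra_F p_F by (rule measurable_from_subalg)
  have [measurable]: "Y \<in> borel_measurable M"
    using subalgebra_F Y by (rule measurable_from_subalg)
  have h_meas [measurable]: "h \<in> borel_measurable M" unfolding h_def by measurable
  have h_le: "\<bar>h \<omega>\<bar> \<le> 1" for \<omega>
    unfolding h_def by (rule abs_of_bool_minus_trans_prob_le)
  have h_int: "integrable M h"
    using h_le by (intro integrable_const_bound[where B=1]) auto
  have "AE \<omega> in M. real_cond_exp M (F k) h \<omega> = 0"
  proof (rule sub.real_cond_exp_charact)
    fix A assume A: "A \<in> sets (F k)"
    then have A_M [measurable]: "A \<in> sets M" using hist_sets_subset by auto
    have "(\<integral>\<omega>\<in>A. h \<omega> \<partial>M) = (\<integral>\<omega>. indicator (A \<inter> {\<omega> \<in> space M. D' k \<omega> = d'}) \<omega>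
        - indicator A \<omega> * p (D k \<omega>) (\<Gamma> k \<omega>) d' \<partial>M)"
      unfolding set_lebesgue_integral_def h_def
      by (intro Bochner_Integration.integral_cong) (auto simp: indicator_def)
    also have "\<dots> = measure M (A \<inter> {\<omega> \<in> space M. D' k \<omega> = d'})
        - (\<integral>\<omega>. indicator A \<omega> * p (D k \<omega>) (\<Gamma> k \<omega>) d' \<partial>M)"
    proof (subst Bochner_Integration.integral_diff)
      show "integrable M (\<lambda>\<omega>. indicator (A \<inter> {\<omega> \<in> space M. D' k \<omega> = d'}) \<omega> :: real)"
        by (intro integrable_const_bound[where B=1]) auto
      show "integrable M (\<lambda>\<omega>. indicator A \<omega> * p (D k \<omega>) (\<Gamma> k \<omega>) d')"
        by (intro integrable_const_bound[where B=1])
          (auto simp: indicator_def trans_prob_nonneg trans_prob_le_1)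
    qed simp
    also have "\<dots> = 0" using next_law A by simp
    finally show "(\<integral>\<omega>\<in>A. h \<omega> \<partial>M) = (\<integral>\<omega>\<in>A. 0 \<partial>M)" by (simp add: set_lebesgue_integral_def)
  qed (use h_int in auto)
  then have "(\<integral>\<omega>. Y \<omega> * real_cond_exp M (F k) h \<omega> \<partial>M) = (\<integral>\<omega>. 0 \<partial>M)"
    by (intro integral_cong_AE) auto
  moreover have "integrable M (\<lambda>\<omega>. Y \<omega> * h \<omega>)"
  proof (rule integrable_const_bound[where B=B])
    show "AE \<omega> in M. norm (Y \<omega> * h \<omega>) \<le> B"
      using mult_mono[OF bdd h_le] order_trans[OF abs_ge_zero bdd] by (intro AE_I2) (auto simp: abs_mult)
  qed measurable
  ultimately show ?thesis
    using sub.real_cond_exp_intg(2)[of Y h] Y by (simp add: h_def)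
qed

text \<open>Summing the centred indicators over \<open>E\<close>, where the transition probabilities
  add up to 1, shows that the nonnegative indicator of leaving \<open>E\<close> has integral
  0.\<close>

lemma AE_next_state_in_emp_set: "AE \<omega> in M. \<forall>k. D' k \<omega> \<in> E"
  unfolding AE_all_countable
proof
  fix k
  have [measurable]: "D' k \<in> measurable M (count_space UNIV)" by (rule D'_meas)
  have [measurable]: "(\<lambda>\<omega>. p (D k \<omega>) (\<Gamma> k \<omega>) d') \<in> borel_measurable M" for d'
    using subalgebra_F p_F by (rule measurable_from_subalg)
  have [measurable]: "(\<lambda>\<omega>. of_bool (D' k \<omega> \<in> E) :: real) \<in> borel_measurable M"
    by (rule measurable_compose[OF D'_meas]) simp
  have int: "integrable M (\<lambda>\<omega>. of_bool (D' k \<omega> = d') - p (D k \<omega>) (\<Gamma> k \<omega>) d')" for d'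
    by (intro integrable_const_bound[where B=1])
      (auto simp only: real_norm_def abs_of_bool_minus_trans_prob_le intro!: AE_I2, measurable)
  have "of_bool (D' k \<omega> \<in> E) - 1 = (\<Sum>d'\<in>E. of_bool (D' k \<omega> = d') - p (D k \<omega>) (\<Gamma> k \<omega>) d')" for \<omega>
  proof -
    have "(\<Sum>d'\<in>E. of_bool (D' k \<omega> = d')) = (of_bool (D' k \<omega> \<in> E) :: real)"
      by (simp add: of_bool_def)
    then show ?thesis using trans_prob_sum[OF n_pos] by (simp add: sum_subtractf)
  qed
  then have "(\<integral>\<omega>. of_bool (D' k \<omega> \<in> E) - 1 \<partial>M)
      = (\<Sum>d'\<in>E. \<integral>\<omega>. of_bool (D' k \<omega> = d') - p (D k \<omega>) (\<Gamma> k \<omega>) d' \<partial>M)"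
    using int by simp
  also have "\<dots> = 0"
    using next_state_orthogonal[of "\<lambda>_. 1" k 1] by simp
  finally have "(\<integral>\<omega>. 1 - of_bool (D' k \<omega> \<in> E) \<partial>M) = (0 :: real)"
    using Bochner_Integration.integral_minus[of M "\<lambda>\<omega>. of_bool (D' k \<omega> \<in> E) - 1 :: real"] by simp
  then have "AE \<omega> in M. 1 - of_bool (D' k \<omega> \<in> E) = (0 :: real)"
    by (subst (asm) integral_nonneg_eq_0_iff_AE) (auto intro!: integrable_const_bound[where B=1])
  then show "AE \<omega> in M. D' k \<omega> \<in> E"
    by eventually_elim (auto split: if_splits)
qed

definition noise_bound :: real where
  "noise_bound = \<beta> * (\<Sum>d'\<in>E. Q_bound)"

sublocale mds: martingale_differences M F noise noise_bound
proof
  fix k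
  show "subalgebra M (F k)" by (rule subalgebra_F)
  show "sets (F k) \<subseteq> sets (F (Suc k))" using hist_sets_Suc by simp
  show "noise k \<in> borel_measurable (F (Suc k))"
  proof -
    note [measurable] = measurable_F_Suc[OF V_F] measurable_F_Suc[OF p_F] D'_F
    show ?thesis unfolding noise_def by measurable
  qed
  show "\<bar>noise k \<omega>\<bar> \<le> noise_bound" if "\<omega> \<in> space M" for \<omega>
  proof -
    have "\<bar>V k \<omega> d'\<bar> * \<bar>of_bool (D' k \<omega> = d') - p (D k \<omega>) (\<Gamma> k \<omega>) d'\<bar> \<le> Q_bound * 1" for d'
      by (intro mult_mono abs_of_bool_minus_trans_prob_le V_bounded[OF that] abs_ge_zero
          order_trans[OF abs_ge_zero V_bounded[OF that]])
    then have "\<bar>V k \<omega> d' * (of_bool (D' k \<omega> = d') - p (D k \<omega>) (\<Gamma> k \<omega>) d')\<bar> \<le> Q_bound" for d'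
      by (simp only: abs_mult mult_1_right)
    then have "\<bar>\<Sum>d'\<in>E. V k \<omega> d' * (of_bool (D' k \<omega> = d') - p (D k \<omega>) (\<Gamma> k \<omega>) d')\<bar> \<le> (\<Sum>d'\<in>E. Q_bound)"
      by (intro order_trans[OF sum_abs] sum_mono)
    then show ?thesis
      unfolding noise_def noise_bound_def using \<beta>_pos by (simp only: abs_mult abs_of_pos mult_left_mono less_imp_le)
  qed
  show "(\<integral>\<omega>. X \<omega> * noise k \<omega> \<partial>M) = 0"
    if X: "X \<in> borel_measurable (F k)" and bdd: "\<And>\<omega>. \<omega> \<in> space M \<Longrightarrow> \<bar>X \<omega>\<bar> \<le> B" for X B
  proof -
    \<comment> \<open>\<open>V k\<close> is a function of the past and can be moved into the test
      function.\<close>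
    define Y where "Y = (\<lambda>d' \<omega>. X \<omega> * V k \<omega> d')"
    have Y_F: "Y d' \<in> borel_measurable (F k)" for d'
      unfolding Y_def using X V_F by (rule borel_measurable_times)
    have Y_le: "\<bar>Y d' \<omega>\<bar> \<le> B * Q_bound" if "\<omega> \<in> space M" for d' \<omega>
      unfolding Y_def abs_mult
      using bdd[OF that] V_bounded[OF that] order_trans[OF abs_ge_zero bdd[OF that]] by (intro mult_mono) auto
    define h where "h = (\<lambda>d' \<omega>. of_bool (D' k \<omega> = d') - p (D k \<omega>) (\<Gamma> k \<omega>) d')"
    have [measurable]: "D' k \<in> measurable M (count_space UNIV)" by (rule D'_meas)
    have [measurable]: "(\<lambda>\<omega>. p (D k \<omega>) (\<Gamma> k \<omega>) d') \<in> borel_measurable M" "Y d' \<in> borel_measurable M" for d'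
      using subalgebra_F p_F Y_F by (blast intro: measurable_from_subalg)+
    have h_le: "\<bar>h d' \<omega>\<bar> \<le> 1" for d' \<omega>
      unfolding h_def by (rule abs_of_bool_minus_trans_prob_le)
    have int: "integrable M (\<lambda>\<omega>. Y d' \<omega> * h d' \<omega>)" for d'
    proof (rule integrable_const_bound[where B="B * Q_bound"])
      show "AE \<omega> in M. norm (Y d' \<omega> * h d' \<omega>) \<le> B * Q_bound"
        using mult_mono[OF Y_le h_le] order_trans[OF abs_ge_zero Y_le] by (intro AE_I2) (auto simp: abs_mult)
    qed (unfold h_def, measurable)
    have "(\<integral>\<omega>. X \<omega> * noise k \<omega> \<partial>M) = (\<integral>\<omega>. \<beta> * (\<Sum>d'\<in>E. Y d' \<omega> * h d' \<omega>) \<partial>M)"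
      by (simp add: noise_def Y_def h_def sum_distrib_left mult_ac)
    also have "\<dots> = \<beta> * (\<Sum>d'\<in>E. \<integral>\<omega>. Y d' \<omega> * h d' \<omega> \<partial>M)"
      using int by simp
    also have "\<dots> = 0"
      using next_state_orthogonal[OF Y_F Y_le] by (simp add: h_def)
    finally show ?thesis .
  qed
qed

text \<open>Almost every path meets the hypotheses of \<open>async_contraction_tendsto_zero\<close>
  for the error \<open>Q k - Qs\<close>. One noise term serves all pairs, since \<open>rate\<close>
  switches it off for those not being visited.\<close>

lemma AE_qlearn_tendsto_Qstar: "AE \<omega> in M. \<forall>d\<in>E. \<forall>\<gamma>. (\<lambda>k. Q k \<omega> d \<gamma>) \<longlonglongrightarrow> Qs d \<gamma>"
proof -
  have rate_le_1: "0 \<le> rate k \<omega> d \<gamma> \<and> rate k \<omega> d \<gamma> \<le> 1" if "\<omega> \<in> space M" for k \<omega> d \<gamma>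
    using \<eta>_range[OF that] by (simp add: rate_def)
  have "AE \<omega> in M. summable (\<lambda>k. rate k \<omega> d \<gamma> * noise k \<omega>)" if d: "d \<in> E" for d \<gamma>
  proof (rule mds.AE_summable)
    show "AE \<omega> in M. summable (\<lambda>k. (rate k \<omega> d \<gamma>)\<^sup>2)"
      using rate_sq
    proof eventually_elim
      case (elim \<omega>)
      then have "summable (\<lambda>k. if D k \<omega> = d \<and> \<Gamma> k \<omega> = \<gamma> then (\<eta> k \<omega> d \<gamma>)\<^sup>2 else 0)"
        using d by blast
      then show ?case by (rule back_subst) (auto simp: rate_def fun_eq_iff intro!: arg_cong[where f=summable])
    qed
  qed (use rate_F rate_le_1 in auto)
  then have "AE \<omega> in M. \<forall>d\<in>E. \<forall>\<gamma>\<in>UNIV. summable (\<lambda>k. rate k \<omega> d \<gamma> * noise k \<omega>)"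
    by (intro AE_finite_allI finite_E) auto
  with AE_space rate_div AE_next_state_in_emp_set show ?thesis
  proof eventually_elim
    case (elim \<omega>)
    define q where "q = (\<lambda>k (d, \<gamma>). Q k \<omega> d \<gamma> - Qs d \<gamma>)"
    \<comment> \<open>As \<open>Qs\<close> is fixed by the Bellman operator, \<open>err\<close> is
      the exact backup of \<open>Q k\<close> minus \<open>Qs\<close>, and the contraction bounds it
      by the current error.\<close>
    define err where "err = (\<lambda>k (d, \<gamma>).
      bellman \<beta> E (cbar n c) p (Q k \<omega>) d \<gamma> - bellman \<beta> E (cbar n c) p Qs d \<gamma>)"
    have Qs: "Qs d \<gamma> = bellman \<beta> E (cbar n c) p Qs d \<gamma>" if "d \<in> E" for d \<gamma>
      using Qstar_bellman[OF n_pos, of \<beta> f PW c] \<beta>_pos \<beta>_less_1 that by auto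
    have "(\<lambda>k. q k s) \<longlonglongrightarrow> 0" if "s \<in> E \<times> UNIV" for s
    proof (rule async_contraction_tendsto_zero)
      show "finite (E \<times> (UNIV :: ('x \<Rightarrow> 'u) set))" by simp
      show "s \<in> E \<times> UNIV" by fact
      show "0 \<le> \<beta>" "\<beta> < 1" using \<beta>_pos \<beta>_less_1 by auto
    next
      fix k and s :: "('x \<Rightarrow> real) \<times> ('x \<Rightarrow> 'u)" assume s: "s \<in> E \<times> UNIV"
      obtain d \<gamma> where [simp]: "s = (d, \<gamma>)" and d: "d \<in> E" using s by auto
      show "0 \<le> (\<lambda>(d, \<gamma>). rate k \<omega> d \<gamma>) s" "(\<lambda>(d, \<gamma>). rate k \<omega> d \<gamma>) s \<le> 1"
        using rate_le_1[OF elim(1)] by auto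
      show "\<not> summable (\<lambda>k. (\<lambda>(d, \<gamma>). rate k \<omega> d \<gamma>) s)"
        using elim(2) d by (simp add: rate_def)
      show "summable (\<lambda>k. (\<lambda>(d, \<gamma>). rate k \<omega> d \<gamma>) s * noise k \<omega>)"
        using elim(4) d by simp
      show "\<bar>q k s\<bar> \<le> Q_bound + (\<Sum>(d, \<gamma>)\<in>E \<times> UNIV. \<bar>Qs d \<gamma>\<bar>)"
      proof -
        have "(\<lambda>(d, \<gamma>). \<bar>Qs d \<gamma>\<bar>) (d, \<gamma>) \<le> (\<Sum>(d, \<gamma>)\<in>E \<times> UNIV. \<bar>Qs d \<gamma>\<bar>)"
          using d by (intro member_le_sum) auto
        then show ?thesis
          using Q_bounded[OF elim(1), of k d \<gamma>] by (simp add: q_def)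
      qed
      show "\<bar>err k s\<bar> \<le> \<beta> * B" if "\<And>s'. s' \<in> E \<times> UNIV \<Longrightarrow> \<bar>q k s'\<bar> \<le> B" for B
        using that d by (auto simp: err_def q_def intro!: mdp.bellman_contraction)
      show "q (Suc k) s = (1 - (\<lambda>(d, \<gamma>). rate k \<omega> d \<gamma>) s) * q k s
          + (\<lambda>(d, \<gamma>). rate k \<omega> d \<gamma>) s * (err k s + noise k \<omega>)"
      proof (cases "D k \<omega> = d \<and> \<Gamma> k \<omega> = \<gamma>")
        case True
        \<comment> \<open>The sampled value is its conditional mean plus noise. This needs
          \<open>(d, \<gamma>)\<close> to be the visited pair, at which \<open>noise\<close> is
          centred; for other pairs both sides of the recursion reduce to
          \<open>q k s\<close>.\<close>
        have "\<beta> * V k \<omega> (D' k \<omega>) = noise k \<omega> + \<beta> * (\<Sum>d'\<in>E. p d \<gamma> d' * V k \<omega> d')"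
          unfolding V_D'[OF elim(1)] noise_def using True
          by (simp add: algebra_simps sum_subtractf)
        then have "cbar n c d \<gamma> + \<beta> * V k \<omega> (D' k \<omega>) = Qs d \<gamma> + (err k s + noise k \<omega>)"
          using Qs[OF d, of \<gamma>] by (simp add: err_def bellman_def[of _ _ _ _ "Q k \<omega>"] V_def)
        then have "q (Suc k) s = (1 - rate k \<omega> d \<gamma>) * Q k \<omega> d \<gamma>
            + rate k \<omega> d \<gamma> * (Qs d \<gamma> + (err k s + noise k \<omega>)) - Qs d \<gamma>"
          by (simp only: q_def Q_Suc \<open>s = (d, \<gamma>)\<close> prod.case)
        then show ?thesis
          by (simp add: q_def algebra_simps)
      qed (auto simp: q_def Q_Suc rate_def)
    qed
    then have "(\<lambda>k. Q k \<omega> d \<gamma> - Qs d \<gamma>) \<longlonglongrightarrow> 0" if "d \<in> E" for d \<gamma>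
      using that by (force simp: q_def)
    then show ?case by (auto intro: LIM_zero_cancel)
  qed
qed

end

section \<open>From convergent Q-values to optimal greedy laws\<close>

lemma eventually_less_tendsto:
  fixes X Y :: "nat \<Rightarrow> real"
  assumes "X \<longlonglongrightarrow> a" "Y \<longlonglongrightarrow> b" "a < b"
  shows "\<forall>\<^sub>F k in sequentially. X k < Y k"
proof -
  have "\<forall>\<^sub>F k in sequentially. 0 < Y k - X k"
    using assms by (intro order_tendstoD(1)[OF tendsto_diff]) auto
  then show ?thesis by eventually_elim simp
qed

text \<open>The finitely many strict inequalities between values of \<open>L\<close> are eventually
  inherited by \<open>Q k\<close>, so a law strictly worse in the limit is no longer chosen. With
  ties the greedy laws may keep switching, but only among minimisers of \<open>L\<close>.\<close>

lemma eventually_greedy_for_limit: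
  fixes Q :: "nat \<Rightarrow> 'd \<Rightarrow> 'g::finite \<Rightarrow> real"
  assumes "finite S" and lim: "\<And>d \<gamma>. d \<in> S \<Longrightarrow> (\<lambda>k. Q k d \<gamma>) \<longlonglongrightarrow> L d \<gamma>"
    and greedy: "\<And>k d \<gamma>. d \<in> S \<Longrightarrow> Q k d (h k d) \<le> Q k d \<gamma>"
  shows "\<forall>\<^sub>F k in sequentially. \<forall>d\<in>S. \<forall>\<gamma>. L d (h k d) \<le> L d \<gamma>"
proof -
  have "\<forall>\<^sub>F k in sequentially. L d \<gamma> < L d \<gamma>' \<longrightarrow> Q k d \<gamma> < Q k d \<gamma>'" if "d \<in> S" for d \<gamma> \<gamma>'
    using eventually_less_tendsto[OF lim[OF that] lim[OF that], of \<gamma> \<gamma>']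
    by (cases "L d \<gamma> < L d \<gamma>'") auto
  then have "\<forall>\<^sub>F k in sequentially. \<forall>d\<in>S. \<forall>\<gamma>\<in>UNIV. \<forall>\<gamma>'\<in>UNIV. L d \<gamma> < L d \<gamma>' \<longrightarrow> Q k d \<gamma> < Q k d \<gamma>'"
    using \<open>finite S\<close> by (intro eventually_ball_finite ballI) auto
  then show ?thesis
    by eventually_elim (use greedy in \<open>force simp: not_le[symmetric]\<close>)
qed

theorem theorem5:
  fixes n :: nat and \<beta> :: real
    and f :: "'x::finite \<Rightarrow> 'u::finite \<Rightarrow> ('x \<times> 'u \<Rightarrow> real) \<Rightarrow> 'w::finite \<Rightarrow> 'x"
    and PW :: "'w pmf"
    and c :: "'x \<Rightarrow> 'u \<Rightarrow> ('x \<times> 'u \<Rightarrow> real) \<Rightarrow> real"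
    and mu0 :: "(nat \<Rightarrow> 'x) pmf"
    and M :: "'a measure"
    and D :: "nat \<Rightarrow> 'a \<Rightarrow> ('x \<Rightarrow> real)"
    and \<Gamma> :: "nat \<Rightarrow> 'a \<Rightarrow> ('x \<Rightarrow> 'u)"
    and D' :: "nat \<Rightarrow> 'a \<Rightarrow> ('x \<Rightarrow> real)"
    and \<eta> :: "nat \<Rightarrow> 'a \<Rightarrow> ('x \<Rightarrow> real) \<Rightarrow> ('x \<Rightarrow> 'u) \<Rightarrow> real"
  assumes n_pos: "n \<ge> 1"
    and beta: "0 < \<beta>" "\<beta> < 1"
    and c_nonneg: "\<And>x u z. c x u z \<ge> 0"
    and M_prob: "prob_space M"
    and D_meas: "\<And>k. D k \<in> measurable M (count_space UNIV)"
    and \<Gamma>_meas: "\<And>k. \<Gamma> k \<in> measurable M (count_space UNIV)"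
    and D'_meas: "\<And>k. D' k \<in> measurable M (count_space UNIV)"
    and \<eta>_meas: "\<And>k d \<gamma>. (\<lambda>\<omega>. \<eta> k \<omega> d \<gamma>) \<in> borel_measurable M"
    and D_range: "\<And>k \<omega>. \<omega> \<in> space M \<Longrightarrow> D k \<omega> \<in> emp_set n"
    and \<eta>_range: "\<And>k \<omega> d \<gamma>. \<omega> \<in> space M \<Longrightarrow> 0 \<le> \<eta> k \<omega> d \<gamma> \<and> \<eta> k \<omega> d \<gamma> \<le> 1"
    and \<eta>_init: "\<And>\<omega> d \<gamma>. \<omega> \<in> space M \<Longrightarrow> \<eta> 0 \<omega> d \<gamma> = 1"
    and next_law: "\<And>k d'' A. A \<in> hist_sets M D \<Gamma> D' \<eta> k \<Longrightarrow>
        measure M (A \<inter> {\<omega> \<in> space M. D' k \<omega> = d''})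
          = (\<integral>\<omega>. indicator A \<omega> * trans_prob n f PW (D k \<omega>) (\<Gamma> k \<omega>) d'' \<partial>M)"
    and rate_div: "AE \<omega> in M. \<forall>d\<in>emp_set n. \<forall>\<gamma>.
        \<not> summable (\<lambda>k. if D k \<omega> = d \<and> \<Gamma> k \<omega> = \<gamma> then \<eta> k \<omega> d \<gamma> else 0)"
    and rate_sq: "AE \<omega> in M. \<forall>d\<in>emp_set n. \<forall>\<gamma>.
        summable (\<lambda>k. if D k \<omega> = d \<and> \<Gamma> k \<omega> = \<gamma> then (\<eta> k \<omega> d \<gamma>)\<^sup>2 else 0)"
    and visits: "AE \<omega> in M. \<forall>d\<in>emp_set n. \<forall>\<gamma>. infinite {k. D k \<omega> = d \<and> \<Gamma> k \<omega> = \<gamma>}"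
  shows "(\<forall>d\<in>emp_set n. \<forall>\<gamma>. AE \<omega> in M.
            (\<lambda>k. qlearn \<beta> (cbar n c) (\<lambda>j. D j \<omega>) (\<lambda>j. \<Gamma> j \<omega>) (\<lambda>j. D' j \<omega>) (\<lambda>j. \<eta> j \<omega>) k d \<gamma>)
              \<longlonglongrightarrow> Qstar n f PW c \<beta> d \<gamma>)
       \<and> (\<forall>g :: nat \<Rightarrow> 'a \<Rightarrow> 'x \<Rightarrow> ('x \<Rightarrow> real) \<Rightarrow> 'u.
            (\<forall>k \<omega> d \<gamma>'. \<omega> \<in> space M \<longrightarrow> d \<in> emp_set n \<longrightarrow>
               qlearn \<beta> (cbar n c) (\<lambda>j. D j \<omega>) (\<lambda>j. \<Gamma> j \<omega>) (\<lambda>j. D' j \<omega>) (\<lambda>j. \<eta> j \<omega>) k d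
                  (\<lambda>x. g k \<omega> x d)
               \<le> qlearn \<beta> (cbar n c) (\<lambda>j. D j \<omega>) (\<lambda>j. \<Gamma> j \<omega>) (\<lambda>j. D' j \<omega>) (\<lambda>j. \<eta> j \<omega>) k d \<gamma>')
            \<longrightarrow> (AE \<omega> in M. (\<lambda>k. Jcost n f PW c \<beta> mu0 (g k \<omega>)) \<longlonglongrightarrow> Jopt n f PW c \<beta> mu0))"
proof -
  interpret prob_space M by (rule M_prob)
  interpret deep_qlearning M n \<beta> f PW c D \<Gamma> D' \<eta>
    by unfold_locales fact+
  show ?thesis
  proof (intro conjI ballI allI impI)
    fix d :: "'x \<Rightarrow> real" and \<gamma> :: "'x \<Rightarrow> 'u" assume "d \<in> emp_set n"
    then show "AE \<omega> in M. (\<lambda>k. qlearn \<beta> (cbar n c) (\<lambda>j. D j \<omega>) (\<lambda>j. \<Gamma> j \<omega>) (\<lambda>j. D' j \<omega>) (\<lambda>j. \<eta> j \<omega>) k d \<gamma>)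
        \<longlonglongrightarrow> Qstar n f PW c \<beta> d \<gamma>"
      using AE_qlearn_tendsto_Qstar by (auto simp: Q_def elim!: eventually_mono)
  next
    fix g :: "nat \<Rightarrow> 'a \<Rightarrow> 'x \<Rightarrow> ('x \<Rightarrow> real) \<Rightarrow> 'u"
    assume "\<forall>k \<omega> d \<gamma>'. \<omega> \<in> space M \<longrightarrow> d \<in> emp_set n \<longrightarrow>
      qlearn \<beta> (cbar n c) (\<lambda>j. D j \<omega>) (\<lambda>j. \<Gamma> j \<omega>) (\<lambda>j. D' j \<omega>) (\<lambda>j. \<eta> j \<omega>) k d (\<lambda>x. g k \<omega> x d)
      \<le> qlearn \<beta> (cbar n c) (\<lambda>j. D j \<omega>) (\<lambda>j. \<Gamma> j \<omega>) (\<lambda>j. D' j \<omega>) (\<lambda>j. \<eta> j \<omega>) k d \<gamma>'"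
    then have greedy: "Q k \<omega> d (\<lambda>x. g k \<omega> x d) \<le> Q k \<omega> d \<gamma>'" if "\<omega> \<in> space M" "d \<in> emp_set n" for k \<omega> d \<gamma>'
      using that by (simp add: Q_def)
    show "AE \<omega> in M. (\<lambda>k. Jcost n f PW c \<beta> mu0 (g k \<omega>)) \<longlonglongrightarrow> Jopt n f PW c \<beta> mu0"
      using AE_space AE_qlearn_tendsto_Qstar
    proof eventually_elim
      case (elim \<omega>)
      have "\<forall>\<^sub>F k in sequentially. \<forall>d\<in>emp_set n. \<forall>\<gamma>.
          Qstar n f PW c \<beta> d (\<lambda>x. g k \<omega> x d) \<le> Qstar n f PW c \<beta> d \<gamma>"
        using finite_emp_set elim(2) greedy[OF elim(1)]
        by (intro eventually_greedy_for_limit[where Q="\<lambda>k. Q k \<omega>" and h="\<lambda>k d x. g k \<omega> x d"]) auto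
      \<comment> \<open>The costs need no continuity in the strategy: from some iteration on they
        equal the optimum.\<close>
      then have "\<forall>\<^sub>F k in sequentially. Jcost n f PW c \<beta> mu0 (g k \<omega>) = Jopt n f PW c \<beta> mu0"
        by eventually_elim (use n_pos beta in \<open>auto intro!: Jcost_greedy_eq_Jopt\<close>)
      then show ?case by (rule tendsto_eventually)
    qed
  qed
qed

end
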